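(* Let $X=\{X(t),\,t\in I\}$ be an $(N,d)$-Gaussian random field whose coordinates are independent copies of a real-valued Gaussian random field $X_0$, where $X_0$ has mean zero, continuous covariance function, and satisfies Conditions (C1) and (C2) on $I=[0,1]^N$ with index $H=(H_1,\ldots,H_N)\in(0,1)^N$. Then, for every $x\in\mathbb{R}^d$, $L_\varepsilon(x,I,X)$ converges in $L^2(\Omega,\mathbb{P})$, as $\varepsilon\to 0$, to a limit $L(x,I,X)$ if and only if $$\sum_{j=1}^N \frac{1}{H_j}>d.$$
   Context: $N,d\ge 1$ are integers and $I=[0,1]^N$. An $(N,d)$-Gaussian random field $X=\{X(t)\}$ is $X(t)=(X_1(t),\ldots,X_d(t))$ with values in $\mathbb{R}^d$, where $X_1,\ldots,X_d$ are independent copies of a real-valued centered Gaussian random field $X_0$ with continuous covariance function $R(s,t)=\mathbb{E}[X_0(s)X_0(t)]$. Sample paths are taken to be continuous on $I$ (the probability space is the space of continuous $\mathbb{R}^d$-valued functions on $I$). Condition (C1) with index $H$: there is a constant $0<c_1<\infty$ such that $\mathbb{E}[(X_0(s)-X_0(t))^2]\le c_1\sum_{j=1}^N|s_j-t_j|^{2H_j}$ for all $s,t\in I$. Condition (C2) with index $H$: there is a constant $c_2>0$ such that $\mathrm{Var}(X_0(t)\mid X_0(s))\ge c_2\sum_{j=1}^N\min\{|s_j-t_j|^{2H_j},|t_j|^{2H_j}\}$ for all $s,t\in I$, where $\mathrm{Var}(X_0(t)\mid X_0(s))$ is the conditional variance of $X_0(t)$ given $X_0(s)$. For $\varepsilon>0$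 let $p_\varepsilon(x)=(2\pi\varepsilon)^{-d/2}\exp(-\|x\|^2/(2\varepsilon))$, $x\in\mathbb{R}^d$, and $L_\varepsilon(x,I,X)=\int_I p_\varepsilon(X(s)-x)\,ds$. The limit $L(x,I,X)$, when it exists, is called the local time of $X$ on $I$ at $x$. *)

theory Defs
  imports "HOL-Probability.Probability"
begin

abbreviation unit_cube :: "(real ^ 'n) set" where
  "unit_cube \<equiv> cbox 0 1"

text \<open>Constants count as (degenerate) Gaussian random variables: the variance of \<open>X\<^sub>0(0)\<close>, for
  instance, is allowed to vanish.\<close>

definition gaussian_rv :: "'a measure \<Rightarrow> ('a \<Rightarrow> real) \<Rightarrow> bool" where
  "gaussian_rv M Y \<longleftrightarrow> Y \<in> borel_measurable M \<and>
     ((\<exists>\<mu>. AE \<omega> in M. Y \<omega> = \<mu>) \<or>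
      (\<exists>\<mu> \<sigma>. \<sigma> > 0 \<and> distributed M lborel Y (\<lambda>y. ennreal (normal_density \<mu> \<sigma> y))))"

definition gaussian_field :: "'a measure \<Rightarrow> 't set \<Rightarrow> ('t \<Rightarrow> 'a \<Rightarrow> real) \<Rightarrow> bool" where
  "gaussian_field M T X \<longleftrightarrow>
     (\<forall>F a. finite F \<and> F \<subseteq> T \<longrightarrow> gaussian_rv M (\<lambda>\<omega>. \<Sum>t\<in>F. a t * X t \<omega>))"

definition covariance_fun :: "'a measure \<Rightarrow> ('t \<Rightarrow> 'a \<Rightarrow> real) \<Rightarrow> 't \<Rightarrow> 't \<Rightarrow> real" where
  "covariance_fun M X s t = (\<integral>\<omega>. X s \<omega> * X t \<omega> \<partial>M)"

definition centered_gaussian_field ::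
    "'a measure \<Rightarrow> ('t::topological_space) set \<Rightarrow> ('t \<Rightarrow> 'a \<Rightarrow> real) \<Rightarrow> bool" where
  "centered_gaussian_field M T X \<longleftrightarrow>
     gaussian_field M T X \<and>
     (\<forall>t\<in>T. (\<integral>\<omega>. X t \<omega> \<partial>M) = 0) \<and>
     continuous_on (T \<times> T) (\<lambda>(s, t). covariance_fun M X s t)"

text \<open>Conditional variance of \<open>Y\<close> given (the sigma-algebra generated by) \<open>Z\<close>, as a random
  variable determined up to null sets.\<close>

definition cond_variance :: "'a measure \<Rightarrow> ('a \<Rightarrow> real) \<Rightarrow> ('a \<Rightarrow> real) \<Rightarrow> 'a \<Rightarrow> real" where
  "cond_variance M Y Z =
     (let G = vimage_algebra (space M) Z borel
      in real_cond_exp M G (\<lambda>\<omega>. (Y \<omega> - real_cond_exp M G Y \<omega>)\<^sup>2))"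

definition condition_C1 ::
    "'a measure \<Rightarrow> (real ^ 'n \<Rightarrow> 'a \<Rightarrow> real) \<Rightarrow> real ^ 'n \<Rightarrow> bool" where
  "condition_C1 M X H \<longleftrightarrow> (\<exists>c>0. \<forall>s\<in>unit_cube. \<forall>t\<in>unit_cube.
     (\<integral>\<omega>. (X s \<omega> - X t \<omega>)\<^sup>2 \<partial>M) \<le> c * (\<Sum>j\<in>UNIV. \<bar>s $ j - t $ j\<bar> powr (2 * H $ j)))"

definition condition_C2 ::
    "'a measure \<Rightarrow> (real ^ 'n \<Rightarrow> 'a \<Rightarrow> real) \<Rightarrow> real ^ 'n \<Rightarrow> bool" where
  "condition_C2 M X H \<longleftrightarrow> (\<exists>c>0. \<forall>s\<in>unit_cube. \<forall>t\<in>unit_cube.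
     AE \<omega> in M. cond_variance M (X t) (X s) \<omega> \<ge>
       c * (\<Sum>j\<in>UNIV. min (\<bar>s $ j - t $ j\<bar> powr (2 * H $ j)) (\<bar>t $ j\<bar> powr (2 * H $ j))))"

text \<open>A random field on \<open>T\<close> is viewed as a random element of the product space over \<open>T\<close>; equality
  of laws there is equality of all finite-dimensional distributions. The copied field \<open>X0\<close> may
  live on a probability space of its own.\<close>

definition independent_copies ::
    "'a measure \<Rightarrow> ('t \<Rightarrow> 'a \<Rightarrow> real ^ 'd) \<Rightarrow> 'b measure \<Rightarrow> ('t \<Rightarrow> 'b \<Rightarrow> real) \<Rightarrow> 't set \<Rightarrow> bool" where
  "independent_copies M X M0 X0 T \<longleftrightarrow>
     prob_space.indep_vars M (\<lambda>_. Pi\<^sub>M T (\<lambda>_. borel)) (\<lambda>i \<omega>. \<lambda>t\<in>T. X t \<omega> $ i) UNIV \<and>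
     (\<forall>i. distr M (Pi\<^sub>M T (\<lambda>_. borel)) (\<lambda>\<omega>. \<lambda>t\<in>T. X t \<omega> $ i) =
          distr M0 (Pi\<^sub>M T (\<lambda>_. borel)) (\<lambda>\<omega>. \<lambda>t\<in>T. X0 t \<omega>))"

definition heat_kernel :: "real \<Rightarrow> real ^ 'd \<Rightarrow> real" where
  "heat_kernel \<epsilon> x =
     (2 * pi * \<epsilon>) powr (- real CARD('d) / 2) * exp (- (norm x)\<^sup>2 / (2 * \<epsilon>))"

definition approx_local_time ::
    "real \<Rightarrow> real ^ 'd \<Rightarrow> (real ^ 'n) set \<Rightarrow> (real ^ 'n \<Rightarrow> 'a \<Rightarrow> real ^ 'd) \<Rightarrow> 'a \<Rightarrow> real" where
  "approx_local_time \<epsilon> x T X \<omega> = (LINT s:T|lborel. heat_kernel \<epsilon> (X s \<omega> - x))"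

definition square_integrable :: "'a measure \<Rightarrow> ('a \<Rightarrow> real) \<Rightarrow> bool" where
  "square_integrable M Y \<longleftrightarrow> Y \<in> borel_measurable M \<and> integrable M (\<lambda>\<omega>. (Y \<omega>)\<^sup>2)"

text \<open>Requiring membership in \<open>L\<^sup>2\<close> explicitly matters, as the Bochner integral of a
  non-integrable function is 0.\<close>

definition tendsto_L2 ::
    "'a measure \<Rightarrow> ('e \<Rightarrow> 'a \<Rightarrow> real) \<Rightarrow> ('a \<Rightarrow> real) \<Rightarrow> 'e filter \<Rightarrow> bool" where
  "tendsto_L2 M Y L F \<longleftrightarrow>
     (\<forall>\<^sub>F e in F. square_integrable M (Y e)) \<and> square_integrable M L \<and>
     ((\<lambda>e. \<integral>\<omega>. (Y e \<omega> - L \<omega>)\<^sup>2 \<partial>M) \<longlongrightarrow> 0) F"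

end

theory Submission
  imports Defs
begin

text \<open>Let \<open>R\<close> be the covariance function of the real field and \<open>Q = \<Sum>1 / H\<^sub>j\<close>. The approximate local times
  converge in \<open>L\<^sup>2\<close> if and only if their mixed second moments \<open>E (L\<^sub>\<epsilon> L\<^sub>\<delta>)\<close> converge. By Fubini's theorem
  and the independence of the coordinates such a moment is the double integral over the cube of an
  explicit kernel: the density at \<open>(x, x)\<close> of a Gaussian vector whose \<open>d\<close> independent coordinate pairs
  have covariance matrix with diagonal \<open>R s s + \<epsilon>, R t t + \<delta>\<close> and off-diagonal entry \<open>R s t\<close>
  (\<open>gaussian_pair_smoothing\<close>, \<open>heat_kernel_cross_moment\<close>, \<open>approx_local_time_cross_moment\<close>).

  As a function of the determinant \<open>\<Delta>\<close> of the unregularised matrix the kernel is at most of order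
  \<open>\<Delta> powr (- d / 2)\<close>. The bound on the conditional variance says that \<open>\<Delta>\<close> is at least of the order of
  \<open>(\<Sum>s\<^sub>j powr 2 H\<^sub>j) * (\<Sum>min \<bar>s\<^sub>j - t\<^sub>j\<bar> t\<^sub>j powr 2 H\<^sub>j)\<close> (\<open>R_det_lower\<close>). Comparing sums with weighted geometric
  means replaces the power \<open>- d / 2\<close> of this expression by a product of one-dimensional singularities
  of exponent \<open>d / Q\<close> (\<open>sum_powr_le_prod_powr\<close>). If \<open>Q > d\<close>, the product is integrable, and dominated
  convergence shows that all mixed moments have the same limit
  (\<open>second_moment_kernel_integral_tendsto\<close>); the approximate local times form a Cauchy family, and
  \<open>L\<^sup>2\<close> is complete.

  Conversely, away from the faces of the cube \<open>\<Delta>\<close> is comparable to the variance of the increment,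
  hence at most of order \<open>\<Sum>\<bar>s\<^sub>j - t\<^sub>j\<bar> powr 2 H\<^sub>j\<close>; the same comparison keeps the exponential factor, the only
  one that involves \<open>x\<close>, away from zero. On the set where this sum is at most of order \<open>4\<^sup>-\<^sup>k\<close>, which has
  measure of order \<open>2 powr (- k Q)\<close>, the kernel is of order at least \<open>2\<^sup>d\<^sup>k\<close> once \<open>\<epsilon>\<close> is below that scale.
  If \<open>Q \<le> d\<close>, each of the scales above \<open>\<epsilon>\<close> contributes at least a fixed amount to the second moment
  \<open>E (L\<^sub>\<epsilon>\<^sup>2)\<close>, which is therefore unbounded (\<open>second_moment_kernel_integral_unbounded\<close>). An \<open>L\<^sup>2\<close> limit
  would keep it bounded.\<close>

section \<open>Square integrable functions\<close>

lemma square_integrable_borel [measurable_dest]: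
  "square_integrable M f \<Longrightarrow> f \<in> borel_measurable M"
  by (simp add: square_integrable_def)

lemma square_integrable_mult:
  assumes "square_integrable M f" "square_integrable M g"
  shows "integrable M (\<lambda>\<omega>. f \<omega> * g \<omega>)"
proof (rule Bochner_Integration.integrable_bound)
  show "integrable M (\<lambda>\<omega>. (f \<omega>)\<^sup>2 + (g \<omega>)\<^sup>2)"
    using assms by (auto simp: square_integrable_def)
  show "(\<lambda>\<omega>. f \<omega> * g \<omega>) \<in> borel_measurable M"
    using assms[THEN square_integrable_borel] by simp
  have "\<bar>x * y\<bar> \<le> x\<^sup>2 + y\<^sup>2" for x y :: real
    using sum_squares_bound[of "\<bar>x\<bar>" "\<bar>y\<bar>"] abs_ge_zero[of "x * y"]
    unfolding abs_mult power2_abs by linarith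
  then show "AE \<omega> in M. norm (f \<omega> * g \<omega>) \<le> norm ((f \<omega>)\<^sup>2 + (g \<omega>)\<^sup>2)"
    by auto
qed

lemma square_integrable_cmult:
  "square_integrable M f \<Longrightarrow> square_integrable M (\<lambda>\<omega>. c * f \<omega>)"
  by (auto simp: square_integrable_def power_mult_distrib)

lemma square_integrable_add:
  assumes "square_integrable M f" "square_integrable M g"
  shows "square_integrable M (\<lambda>\<omega>. f \<omega> + g \<omega>)"
  using assms square_integrable_mult[OF assms]
  by (auto simp: square_integrable_def power2_sum mult.assoc)

lemma square_integrable_diff:
  assumes "square_integrable M f" "square_integrable M g"
  shows "square_integrable M (\<lambda>\<omega>. f \<omega> - g \<omega>)"
  using square_integrable_add[OF assms(1) square_integrable_cmult[OF assms(2), of "-1"]] by simp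

lemma (in prob_space) square_integrable_integrable:
  assumes "square_integrable M f" shows "integrable M f"
  using square_integrable_mult[OF assms, of "\<lambda>_. 1"] by (simp add: square_integrable_def)

lemma integral_square_triangle:
  assumes "square_integrable M f" "square_integrable M g"
  shows "(\<integral>\<omega>. (f \<omega> + g \<omega>)\<^sup>2 \<partial>M) \<le> 2 * (\<integral>\<omega>. (f \<omega>)\<^sup>2 \<partial>M) + 2 * (\<integral>\<omega>. (g \<omega>)\<^sup>2 \<partial>M)"
proof -
  have "(\<integral>\<omega>. (f \<omega> + g \<omega>)\<^sup>2 \<partial>M) \<le> (\<integral>\<omega>. 2 * (f \<omega>)\<^sup>2 + 2 * (g \<omega>)\<^sup>2 \<partial>M)"
  proof (rule integral_mono)
    show "integrable M (\<lambda>\<omega>. (f \<omega> + g \<omega>)\<^sup>2)"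
      using square_integrable_add[OF assms] by (simp add: square_integrable_def)
    show "integrable M (\<lambda>\<omega>. 2 * (f \<omega>)\<^sup>2 + 2 * (g \<omega>)\<^sup>2)"
      using assms by (auto simp: square_integrable_def)
    show "(f \<omega> + g \<omega>)\<^sup>2 \<le> 2 * (f \<omega>)\<^sup>2 + 2 * (g \<omega>)\<^sup>2" for \<omega>
      using sum_squares_bound[of "f \<omega>" "g \<omega>"] by (simp add: power2_sum)
  qed
  then show ?thesis
    using assms by (simp add: square_integrable_def)
qed

text \<open>The classical Riesz--Fischer argument: along a subsequence with rapidly decreasing increments
  the sequence converges almost surely, and Fatou's lemma turns the Cauchy property into
  convergence of the whole sequence to that almost sure limit.\<close>

lemma (in prob_space) L2_complete:
  fixes f :: "nat \<Rightarrow> 'a \<Rightarrow> real"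
  assumes sq: "\<And>n. square_integrable M (f n)"
    and cauchy: "\<And>e. e > 0 \<Longrightarrow> \<exists>N. \<forall>m\<ge>N. \<forall>n\<ge>N. (\<integral>\<omega>. (f m \<omega> - f n \<omega>)\<^sup>2 \<partial>M) < e"
  obtains L where "square_integrable M L" "(\<lambda>n. \<integral>\<omega>. (f n \<omega> - L \<omega>)\<^sup>2 \<partial>M) \<longlonglongrightarrow> 0"
proof -
  note [measurable] = square_integrable_borel[OF sq]
  have "\<forall>k. \<exists>N. \<forall>m\<ge>N. \<forall>n\<ge>N. (\<integral>\<omega>. (f m \<omega> - f n \<omega>)\<^sup>2 \<partial>M) < (1/4)^k"
    using cauchy by simp
  then obtain N0 where N0: "\<And>k m n. m \<ge> N0 k \<Longrightarrow> n \<ge> N0 k \<Longrightarrow> (\<integral>\<omega>. (f m \<omega> - f n \<omega>)\<^sup>2 \<partial>M) < (1/4)^k"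
    by metis
  define r where "r k = (\<Sum>i\<le>k. N0 i) + k" for k
  have r_ge: "N0 k \<le> r k" "N0 k \<le> r (Suc k)" "k \<le> r k" for k
    unfolding r_def using member_le_sum[of k "{..k}" N0] by auto
  define g where "g k \<omega> = \<bar>f (r (Suc k)) \<omega> - f (r k) \<omega>\<bar>" for k \<omega>
  have [measurable]: "g k \<in> borel_measurable M" for k
    unfolding g_def by measurable
  have g_sq: "integrable M (\<lambda>\<omega>. (g k \<omega>)\<^sup>2)" for k
    using square_integrable_diff[OF sq sq] by (simp add: square_integrable_def g_def)
  have g_int: "integrable M (g k)" for k
    unfolding g_def by (intro integrable_abs square_integrable_integrable square_integrable_diff sq)
  have g_le: "(\<integral>\<omega>. g k \<omega> \<partial>M) \<le> (1/2)^k" for k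
  proof -
    \<comment> \<open>The arithmetic-geometric mean inequality, weighted so that an \<open>L\<^sup>2\<close> bound \<open>2\<^sup>-\<^sup>k\<close>
      gives an \<open>L\<^sup>1\<close> bound of the same order.\<close>
    have ineq: "y \<le> (1/2)^k / 2 + 2^k * y\<^sup>2 / 2" for y :: real
    proof -
      have "0 \<le> 2^k * (y - (1/2)^k)\<^sup>2" by simp
      also have "\<dots> = 2^k * y\<^sup>2 - 2 * y + (1/2)^k"
        by (simp add: power2_eq_square algebra_simps power_one_over)
      finally show ?thesis by simp
    qed
    have "(\<integral>\<omega>. g k \<omega> \<partial>M) \<le> (\<integral>\<omega>. (1/2)^k / 2 + 2^k * (g k \<omega>)\<^sup>2 / 2 \<partial>M)"
      using g_sq by (intro integral_mono g_int ineq) auto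
    also have "\<dots> = (1/2)^k / 2 + 2^k * (\<integral>\<omega>. (g k \<omega>)\<^sup>2 \<partial>M) / 2"
      using g_sq[of k] by (simp add: prob_space)
    also have "\<dots> \<le> (1/2)^k / 2 + 2^k * (1/4)^k / 2"
      using N0[OF r_ge(2,1), of k] by (simp add: g_def)
    also have "2^k * (1/4)^k = ((1/2)^k :: real)"
      by (simp add: power_mult_distrib[symmetric])
    finally show ?thesis by simp
  qed
  have "(\<integral>\<^sup>+\<omega>. (\<Sum>k. ennreal (g k \<omega>)) \<partial>M) = (\<Sum>k. \<integral>\<^sup>+\<omega>. ennreal (g k \<omega>) \<partial>M)"
    by (rule nn_integral_suminf) auto
  also have "\<dots> \<le> (\<Sum>k. ennreal ((1/2)^k))"
  proof (rule suminf_le)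
    show "(\<integral>\<^sup>+\<omega>. ennreal (g k \<omega>) \<partial>M) \<le> ennreal ((1/2)^k)" for k
      using g_le[of k] by (subst nn_integral_eq_integral[OF g_int]) (simp_all add: g_def[abs_def])
  qed auto
  also have "\<dots> < \<infinity>"
    by (subst suminf_ennreal2) auto
  finally have "AE \<omega> in M. (\<Sum>k. ennreal (g k \<omega>)) \<noteq> \<infinity>"
    by (intro nn_integral_PInf_AE) auto
  then have conv: "AE \<omega> in M. convergent (\<lambda>k. f (r k) \<omega>)"
  proof eventually_elim
    case (elim \<omega>)
    have "summable (\<lambda>k. g k \<omega>)"
      using elim by (intro summable_suminf_not_top) (auto simp: g_def)
    then have "summable (\<lambda>k. f (r (Suc k)) \<omega> - f (r k) \<omega>)"
      unfolding g_def by (rule summable_rabs_cancel)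
    then have "convergent (\<lambda>n. \<Sum>k<n. f (r (Suc k)) \<omega> - f (r k) \<omega>)"
      by (simp add: summable_iff_convergent)
    then have "convergent (\<lambda>n. f (r n) \<omega> - f (r 0) \<omega>)"
      using sum_lessThan_telescope[of "\<lambda>k. f (r k) \<omega>"] by simp
    then show ?case
      using convergent_add[OF _ convergent_const[of "f (r 0) \<omega>"]] by fastforce
  qed
  define L where "L \<omega> = lim (\<lambda>k. f (r k) \<omega>)" for \<omega>
  have L_meas[measurable]: "L \<in> borel_measurable M"
    unfolding L_def by measurable
  have fatou: "(\<integral>\<^sup>+\<omega>. ennreal ((f n \<omega> - L \<omega>)\<^sup>2) \<partial>M) \<le> ennreal e"
    if N: "\<forall>m\<ge>N. \<forall>n\<ge>N. (\<integral>\<omega>. (f m \<omega> - f n \<omega>)\<^sup>2 \<partial>M) < e" and n: "n \<ge> N" for N n e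
  proof -
    have "(\<integral>\<^sup>+\<omega>. ennreal ((f n \<omega> - L \<omega>)\<^sup>2) \<partial>M)
        = (\<integral>\<^sup>+\<omega>. liminf (\<lambda>k. ennreal ((f n \<omega> - f (r k) \<omega>)\<^sup>2)) \<partial>M)"
    proof (rule nn_integral_cong_AE)
      show "AE \<omega> in M. ennreal ((f n \<omega> - L \<omega>)\<^sup>2) = liminf (\<lambda>k. ennreal ((f n \<omega> - f (r k) \<omega>)\<^sup>2))"
        using conv
      proof eventually_elim
        case (elim \<omega>)
        then have "(\<lambda>k. f (r k) \<omega>) \<longlonglongrightarrow> L \<omega>"
          by (simp add: L_def convergent_LIMSEQ_iff)
        then have "(\<lambda>k. ennreal ((f n \<omega> - f (r k) \<omega>)\<^sup>2)) \<longlonglongrightarrow> ennreal ((f n \<omega> - L \<omega>)\<^sup>2)"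
          by (intro tendsto_intros)
        then show ?case
          using lim_imp_Liminf[OF sequentially_bot] by metis
      qed
    qed
    also have "\<dots> \<le> liminf (\<lambda>k. \<integral>\<^sup>+\<omega>. ennreal ((f n \<omega> - f (r k) \<omega>)\<^sup>2) \<partial>M)"
      by (rule nn_integral_liminf) measurable
    also have "\<dots> \<le> limsup (\<lambda>k. \<integral>\<^sup>+\<omega>. ennreal ((f n \<omega> - f (r k) \<omega>)\<^sup>2) \<partial>M)"
      by (rule Liminf_le_Limsup) simp
    also have "\<dots> \<le> ennreal e"
    proof (rule Limsup_bounded)
      show "\<forall>\<^sub>F k in sequentially. (\<integral>\<^sup>+\<omega>. ennreal ((f n \<omega> - f (r k) \<omega>)\<^sup>2) \<partial>M) \<le> ennreal e"
        using eventually_ge_at_top[of N]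
      proof eventually_elim
        case (elim k)
        have "integrable M (\<lambda>\<omega>. (f n \<omega> - f (r k) \<omega>)\<^sup>2)"
          using square_integrable_diff[OF sq sq] by (simp add: square_integrable_def)
        moreover have "(\<integral>\<omega>. (f n \<omega> - f (r k) \<omega>)\<^sup>2 \<partial>M) < e"
          using N n elim r_ge(3)[of k] by force
        ultimately show ?case
          by (subst nn_integral_eq_integral) (auto intro!: ennreal_leI)
      qed
    qed
    finally show ?thesis .
  qed
  have diff_sq: "square_integrable M (\<lambda>\<omega>. f n \<omega> - L \<omega>)" 
    and diff_le: "(\<integral>\<omega>. (f n \<omega> - L \<omega>)\<^sup>2 \<partial>M) \<le> e"
    if N: "\<forall>m\<ge>N. \<forall>n\<ge>N. (\<integral>\<omega>. (f m \<omega> - f n \<omega>)\<^sup>2 \<partial>M) < e" and n: "n \<ge> N" and e: "e > 0" for N n e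
  proof -
    show sq_n: "square_integrable M (\<lambda>\<omega>. f n \<omega> - L \<omega>)"
      unfolding square_integrable_def
      using fatou[OF N n] by (auto intro!: integrableI_bounded simp: less_top[symmetric] top_unique)
    show "(\<integral>\<omega>. (f n \<omega> - L \<omega>)\<^sup>2 \<partial>M) \<le> e"
      using fatou[OF N n] sq_n e by (subst (asm) nn_integral_eq_integral) (auto simp: square_integrable_def)
  qed
  show thesis
  proof (rule that)
    obtain N where N: "\<forall>m\<ge>N. \<forall>n\<ge>N. (\<integral>\<omega>. (f m \<omega> - f n \<omega>)\<^sup>2 \<partial>M) < 1"
      using cauchy[of 1] by auto
    show "square_integrable M L"
      using square_integrable_diff[OF sq[of N] diff_sq[OF N order_refl]] by simp
    show "(\<lambda>n. \<integral>\<omega>. (f n \<omega> - L \<omega>)\<^sup>2 \<partial>M) \<longlonglongrightarrow> 0"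
    proof (rule LIMSEQ_I)
      fix e :: real assume "e > 0"
      then obtain N where N: "\<forall>m\<ge>N. \<forall>n\<ge>N. (\<integral>\<omega>. (f m \<omega> - f n \<omega>)\<^sup>2 \<partial>M) < e / 2"
        using cauchy[of "e/2"] by auto
      have "norm ((\<integral>\<omega>. (f n \<omega> - L \<omega>)\<^sup>2 \<partial>M) - 0) < e" if "n \<ge> N" for n
        using diff_le[OF N that] \<open>e > 0\<close> by auto
      then show "\<exists>N. \<forall>n\<ge>N. norm ((\<integral>\<omega>. (f n \<omega> - L \<omega>)\<^sup>2 \<partial>M) - 0) < e"
        by blast
    qed
  qed
qed

section \<open>Gaussian laws on the Fourier side\<close>

text \<open>A rescaling of the characteristic function of the standard normal distribution.\<close>

lemma gaussian_fourier:
  fixes A y :: real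
  assumes "A > 0"
  shows "(LINT u|lborel. exp (- A * u\<^sup>2 / 2) *\<^sub>R iexp (y * u))
       = complex_of_real (sqrt (2 * pi / A) * exp (- y\<^sup>2 / (2 * A)))"
proof -
  define t where "t = y / sqrt A"
  have t2: "t\<^sup>2 = y\<^sup>2 / A"
    using assms by (simp add: t_def power_divide)
  have "complex_of_real (exp (- y\<^sup>2 / (2 * A))) = char std_normal_distribution t"
    using assms by (simp add: char_std_normal_distribution t2 mult.commute)
  also have "\<dots> = (LINT w|lborel. std_normal_density w *\<^sub>R iexp (t * w))"
    unfolding char_def by (subst integral_density) auto
  also have "\<dots> = sqrt A *\<^sub>R (LINT u|lborel. std_normal_density (sqrt A * u) *\<^sub>R iexp (t * (sqrt A * u)))"
    using assms by (subst lborel_integral_real_affine[where c = "sqrt A" and t = 0]) auto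
  also have "\<dots> = sqrt A *\<^sub>R (LINT u|lborel. (1 / sqrt (2 * pi)) *\<^sub>R (exp (- A * u\<^sup>2 / 2) *\<^sub>R iexp (y * u)))"
    using assms by (simp add: std_normal_density_def t_def power_mult_distrib)
  also have "\<dots> = (sqrt A / sqrt (2 * pi)) *\<^sub>R (LINT u|lborel. exp (- A * u\<^sup>2 / 2) *\<^sub>R iexp (y * u))"
    by (subst integral_scaleR_right) simp
  finally have "(sqrt (2 * pi) / sqrt A) *\<^sub>R complex_of_real (exp (- y\<^sup>2 / (2 * A)))
      = (LINT u|lborel. exp (- A * u\<^sup>2 / 2) *\<^sub>R iexp (y * u))"
    using assms by simp
  then show ?thesis
    by (simp add: real_sqrt_divide scaleR_conv_of_real)
qed

lemma integrable_gaussian_exp: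
  assumes "A > 0" shows "integrable lborel (\<lambda>u::real. exp (- A * u\<^sup>2 / 2))"
proof -
  have "integrable lborel (\<lambda>u. sqrt (2 * pi / A) * normal_density 0 (1 / sqrt A) u)"
    using assms by auto
  also have "(\<lambda>u. sqrt (2 * pi / A) * normal_density 0 (1 / sqrt A) u) = (\<lambda>u. exp (- A * u\<^sup>2 / 2))"
    using assms by (auto simp: normal_density_def fun_eq_iff field_simps real_sqrt_divide)
  finally show ?thesis .
qed

lemma normal_density_fourier:
  assumes "\<epsilon> > 0"
  shows "complex_of_real (normal_density 0 (sqrt \<epsilon>) y)
       = (1 / (2 * pi)) *\<^sub>R (LINT u|lborel. exp (- \<epsilon> * u\<^sup>2 / 2) *\<^sub>R iexp (y * u))"
proof -
  have "sqrt (2 * pi * \<epsilon>) * sqrt (2 * pi / \<epsilon>) = sqrt ((2 * pi)\<^sup>2)"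
    using assms by (simp add: power2_eq_square flip: real_sqrt_mult)
  also have "\<dots> = 2 * pi"
    by (simp only: real_sqrt_abs) simp
  finally have "sqrt (2 * pi * \<epsilon>) * sqrt (2 * pi / \<epsilon>) = 2 * pi" .
  then have const: "1 / (2 * pi) * sqrt (2 * pi / \<epsilon>) = 1 / sqrt (2 * pi * \<epsilon>)"
    using assms by (simp add: field_simps)
  have "normal_density 0 (sqrt \<epsilon>) y = 1 / sqrt (2 * pi * \<epsilon>) * exp (- y\<^sup>2 / (2 * \<epsilon>))"
    using assms by (simp add: normal_density_def)
  then have "normal_density 0 (sqrt \<epsilon>) y = 1 / (2 * pi) * (sqrt (2 * pi / \<epsilon>) * exp (- y\<^sup>2 / (2 * \<epsilon>)))"
    unfolding const[symmetric] by (simp only: mult.assoc)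
  then show ?thesis
    unfolding gaussian_fourier[OF assms] by (simp only: scaleR_conv_of_real of_real_mult)
qed

lemma normal_density_le:
  assumes "\<epsilon> > 0" shows "normal_density 0 (sqrt \<epsilon>) y \<le> 1 / sqrt (2 * pi * \<epsilon>)"
  using assms by (simp add: normal_density_def field_simps)

text \<open>Smoothing by a Gaussian kernel becomes multiplication by a Gaussian on the Fourier side; the
  bounded weight \<open>W\<close> allows this to be applied to several variables one after the other.\<close>

lemma (in prob_space) normal_density_expectation_fourier:
  fixes W :: "'a \<Rightarrow> complex"
  assumes "\<epsilon> > 0" and Y[measurable]: "Y \<in> borel_measurable M"
    and W[measurable]: "W \<in> borel_measurable M" and K: "\<And>\<omega>. norm (W \<omega>) \<le> K"
  shows "(\<integral>\<omega>. normal_density 0 (sqrt \<epsilon>) (Y \<omega>) *\<^sub>R W \<omega> \<partial>M)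
       = (1 / (2 * pi)) *\<^sub>R (LINT u|lborel. exp (- \<epsilon> * u\<^sup>2 / 2) *\<^sub>R (\<integral>\<omega>. iexp (Y \<omega> * u) * W \<omega> \<partial>M))"
proof -
  interpret P: pair_sigma_finite M lborel ..
  let ?k = "\<lambda>\<omega> u. exp (- \<epsilon> * u\<^sup>2 / 2) *\<^sub>R (iexp (Y \<omega> * u) * W \<omega>)"
  have bound: "norm (?k \<omega> u) \<le> K * exp (- \<epsilon> * u\<^sup>2 / 2)" for \<omega> u
    using K[of \<omega>] unfolding norm_scaleR norm_mult norm_exp_i_times by (simp add: mult.commute)
  have "0 \<le> K"
    using K norm_ge_zero order_trans by blast
  have int: "integrable lborel (\<lambda>u. K * exp (- \<epsilon> * u\<^sup>2 / 2))"
    using integrable_gaussian_exp[OF assms(1)] by simp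
  have meas[measurable]: "case_prod ?k \<in> borel_measurable (M \<Otimes>\<^sub>M lborel)"
    by measurable
  have "integrable (M \<Otimes>\<^sub>M lborel) (case_prod ?k)"
  proof (rule P.Fubini_integrable)
    show "AE \<omega> in M. integrable lborel (\<lambda>u. case_prod ?k (\<omega>, u))"
    proof (intro AE_I2 Bochner_Integration.integrable_bound[OF int])
      show "norm (case_prod ?k (\<omega>, u)) \<le> norm (K * exp (- \<epsilon> * u\<^sup>2 / 2))" for \<omega> u
        using bound[of u \<omega>] unfolding case_prod_conv real_norm_def by linarith
    qed measurable
    show "integrable M (\<lambda>\<omega>. \<integral>u. norm (case_prod ?k (\<omega>, u)) \<partial>lborel)"
    proof (rule integrable_const_bound[where B = "\<integral>u. K * exp (- \<epsilon> * u\<^sup>2 / 2) \<partial>lborel"])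
      show "AE \<omega> in M. norm (\<integral>u. norm (case_prod ?k (\<omega>, u)) \<partial>lborel) \<le> (\<integral>u. K * exp (- \<epsilon> * u\<^sup>2 / 2) \<partial>lborel)"
      proof (rule AE_I2)
        fix \<omega>
        have "(\<integral>u. norm (case_prod ?k (\<omega>, u)) \<partial>lborel) \<le> (\<integral>u. K * exp (- \<epsilon> * u\<^sup>2 / 2) \<partial>lborel)"
          using bound \<open>0 \<le> K\<close> by (intro integral_mono_AE' AE_I2 int) (simp_all only: case_prod_conv, simp_all)
        then show "norm (\<integral>u. norm (case_prod ?k (\<omega>, u)) \<partial>lborel) \<le> (\<integral>u. K * exp (- \<epsilon> * u\<^sup>2 / 2) \<partial>lborel)"
          by (simp add: integral_nonneg_AE)
      qed
    qed measurable
  qed simp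
  then have "(\<integral>u. (\<integral>\<omega>. ?k \<omega> u \<partial>M) \<partial>lborel) = (\<integral>\<omega>. (\<integral>u. ?k \<omega> u \<partial>lborel) \<partial>M)"
    by (rule P.Fubini_integral)
  also have "\<dots> = (\<integral>\<omega>. (\<integral>u. exp (- \<epsilon> * u\<^sup>2 / 2) *\<^sub>R iexp (Y \<omega> * u) \<partial>lborel) * W \<omega> \<partial>M)"
    by (intro Bochner_Integration.integral_cong refl, subst integral_mult_left_zero[symmetric]) simp
  also have "\<dots> = (\<integral>\<omega>. (2 * pi) *\<^sub>R (normal_density 0 (sqrt \<epsilon>) (Y \<omega>) *\<^sub>R W \<omega>) \<partial>M)"
    using normal_density_fourier[OF assms(1)]
    by (intro Bochner_Integration.integral_cong refl) (simp add: scaleR_conv_of_real)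
  also have "\<dots> = (2 * pi) *\<^sub>R (\<integral>\<omega>. normal_density 0 (sqrt \<epsilon>) (Y \<omega>) *\<^sub>R W \<omega> \<partial>M)"
    by (rule integral_scaleR_right)
  finally show ?thesis
    by simp
qed

lemma (in prob_space) gaussian_rv_square_integrable:
  assumes "gaussian_rv M Y" shows "square_integrable M Y"
proof -
  have [measurable]: "Y \<in> borel_measurable M"
    using assms by (simp add: gaussian_rv_def)
  consider \<mu> where "AE \<omega> in M. Y \<omega> = \<mu>" |
    \<mu> \<sigma> where "\<sigma> > 0" "distributed M lborel Y (\<lambda>y. ennreal (normal_density \<mu> \<sigma> y))"
    using assms by (auto simp: gaussian_rv_def)
  then have "integrable M (\<lambda>\<omega>. (Y \<omega>)\<^sup>2)"
  proof cases
    case 1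
    have "integrable M (\<lambda>\<omega>. \<mu>\<^sup>2)" by simp
    also have "?this \<longleftrightarrow> ?thesis"
      using 1 by (intro integrable_cong_AE) (measurable, auto)
    finally show ?thesis .
  next
    case 2
    have "integrable lborel (\<lambda>y. normal_density \<mu> \<sigma> y * (y - \<mu>)^2 + 2 * \<mu> * (normal_density \<mu> \<sigma> y * y) - \<mu>\<^sup>2 * normal_density \<mu> \<sigma> y)"
      using 2(1) by (intro Bochner_Integration.integrable_add Bochner_Integration.integrable_diff integrable_mult_right integrable_normal_moment integrable_normal_moment_nz_1 integrable_normal_density)
    also have "(\<lambda>y. normal_density \<mu> \<sigma> y * (y - \<mu>)^2 + 2 * \<mu> * (normal_density \<mu> \<sigma> y * y) - \<mu>\<^sup>2 * normal_density \<mu> \<sigma> y)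
       = (\<lambda>y. normal_density \<mu> \<sigma> y * y\<^sup>2)"
      by (auto simp: power2_eq_square algebra_simps)
    finally show ?thesis
      using distributed_integrable[OF 2(2), of "\<lambda>y. y\<^sup>2"] by simp
  qed
  then show ?thesis by (simp add: square_integrable_def)
qed

text \<open>A constant with mean zero vanishes, so the degenerate Gaussian variables obey the same formula
  as the variables with a density.\<close>

lemma (in prob_space) gaussian_rv_char:
  assumes G: "gaussian_rv M Y" and m: "(\<integral>\<omega>. Y \<omega> \<partial>M) = 0"
  shows "(\<integral>\<omega>. iexp (Y \<omega>) \<partial>M) = complex_of_real (exp (- (\<integral>\<omega>. (Y \<omega>)\<^sup>2 \<partial>M) / 2))"
proof -
  have [measurable]: "Y \<in> borel_measurable M"
    using G by (simp add: gaussian_rv_def)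
  consider \<mu> where "AE \<omega> in M. Y \<omega> = \<mu>" |
    \<mu> \<sigma> where "\<sigma> > 0" "distributed M lborel Y (\<lambda>y. ennreal (normal_density \<mu> \<sigma> y))"
    using G by (auto simp: gaussian_rv_def)
  then show ?thesis
  proof cases
    case 1
    have "(\<integral>\<omega>. Y \<omega> \<partial>M) = (\<integral>\<omega>. \<mu> \<partial>M)"
      using 1 by (intro integral_cong_AE) auto
    then have "\<mu> = 0" using m by (simp add: prob_space)
    have "(\<integral>\<omega>. iexp (Y \<omega>) \<partial>M) = (\<integral>\<omega>. 1 \<partial>M)"
      using 1 \<open>\<mu> = 0\<close> by (intro integral_cong_AE) auto
    moreover have "(\<integral>\<omega>. (Y \<omega>)\<^sup>2 \<partial>M) = (\<integral>\<omega>. 0 \<partial>M)"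
      using 1 \<open>\<mu> = 0\<close> by (intro integral_cong_AE) auto
    ultimately show ?thesis by (simp add: prob_space)
  next
    case 2
    have "\<mu> = 0"
      using normal_distributed_expectation[OF 2] m by simp
    have var: "(\<integral>\<omega>. (Y \<omega>)\<^sup>2 \<partial>M) = \<sigma>\<^sup>2"
      using normal_distributed_variance[OF 2] m by simp
    have "(\<integral>\<omega>. iexp (Y \<omega>) \<partial>M) = (\<integral>y. iexp y \<partial>distr M lborel Y)"
      by (subst integral_distr) auto
    also have "\<dots> = (LINT y|lborel. normal_density 0 \<sigma> y *\<^sub>R iexp y)"
      unfolding distributed_distr_eq_density[OF 2(2)] \<open>\<mu> = 0\<close>
      by (subst integral_density) auto
    also have "\<dots> = (LINT y|lborel. (1 / sqrt (2 * pi * \<sigma>\<^sup>2)) *\<^sub>R (exp (- (1/\<sigma>\<^sup>2) * y\<^sup>2 / 2) *\<^sub>R iexp (1 * y)))"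
      by (intro Bochner_Integration.integral_cong refl) (simp add: normal_density_def mult.commute)
    also have "\<dots> = (1 / sqrt (2 * pi * \<sigma>\<^sup>2)) *\<^sub>R (LINT y|lborel. exp (- (1/\<sigma>\<^sup>2) * y\<^sup>2 / 2) *\<^sub>R iexp (1 * y))"
      by (rule integral_scaleR_right)
    also have "\<dots> = complex_of_real (exp (- \<sigma>\<^sup>2 / 2))"
      using 2(1) by (subst gaussian_fourier) (auto simp: scaleR_conv_of_real)
    finally show ?thesis unfolding var .
  qed
qed

text \<open>Fourier inversion of a bivariate centred Gaussian density on the diagonal. The shear
  \<open>u \<mapsto> u - (c / A) v\<close> diagonalises the quadratic form and splits the double integral into two
  one-dimensional ones.\<close>

lemma bivariate_gaussian_fourier:
  fixes A B c x :: real
  assumes A: "A > 0" and D: "A * B - c\<^sup>2 > 0"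
  shows "(LINT v|lborel. LINT u|lborel.
            exp (- (A * u\<^sup>2 + 2 * c * u * v + B * v\<^sup>2) / 2) *\<^sub>R iexp (- x * (u + v)))
       = complex_of_real (2 * pi / sqrt (A * B - c\<^sup>2) * exp (- x\<^sup>2 * (A + B - 2 * c) / (2 * (A * B - c\<^sup>2))))"
proof -
  define A' where "A' = (A * B - c\<^sup>2) / A"
  define y where "y = - x * (1 - c / A)"
  have A': "A' > 0" using A D by (simp add: A'_def)
  have inner: "(LINT u|lborel. exp (- (A * u\<^sup>2 + 2 * c * u * v + B * v\<^sup>2) / 2) *\<^sub>R iexp (- x * (u + v)))
      = complex_of_real (sqrt (2 * pi / A) * exp (- x\<^sup>2 / (2 * A))) * (exp (- A' * v\<^sup>2 / 2) *\<^sub>R iexp (y * v))" for v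
  proof -
    have split: "exp (- (A * (- (c/A) * v + u)\<^sup>2 + 2 * c * (- (c/A) * v + u) * v + B * v\<^sup>2) / 2) *\<^sub>R iexp (- x * ((- (c/A) * v + u) + v))
        = (exp (- A * u\<^sup>2 / 2) *\<^sub>R iexp ((- x) * u)) * (exp (- A' * v\<^sup>2 / 2) *\<^sub>R iexp (y * v))" for u
    proof -
      have "- (A * (- (c/A) * v + u)\<^sup>2 + 2 * c * (- (c/A) * v + u) * v + B * v\<^sup>2) / 2 = - A * u\<^sup>2 / 2 + - A' * v\<^sup>2 / 2"
        using A by (simp add: A'_def power2_eq_square field_simps)
      moreover have "- x * ((- (c/A) * v + u) + v) = (- x) * u + y * v"
        by (simp add: y_def algebra_simps)
      ultimately show ?thesis
        by (simp only: exp_add of_real_add distrib_left) (simp add: scaleR_conv_of_real)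
    qed
    have "(LINT u|lborel. exp (- (A * u\<^sup>2 + 2 * c * u * v + B * v\<^sup>2) / 2) *\<^sub>R iexp (- x * (u + v)))
      = (LINT u|lborel. (exp (- A * u\<^sup>2 / 2) *\<^sub>R iexp ((- x) * u)) * (exp (- A' * v\<^sup>2 / 2) *\<^sub>R iexp (y * v)))"
      by (subst lborel_integral_real_affine[where c = 1 and t = "- (c/A) * v"], simp)
        (simp only: split mult_1 abs_one scaleR_one)
    also have "\<dots> = (LINT u|lborel. exp (- A * u\<^sup>2 / 2) *\<^sub>R iexp ((- x) * u)) * (exp (- A' * v\<^sup>2 / 2) *\<^sub>R iexp (y * v))"
      by (rule integral_mult_left_zero)
    finally show ?thesis
      unfolding gaussian_fourier[OF A] by simp
  qed
  have e1: "sqrt (2 * pi / A) * sqrt (2 * pi / A') = 2 * pi / sqrt (A * B - c\<^sup>2)"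
  proof -
    have "sqrt (2 * pi / A) * sqrt (2 * pi / A') = sqrt ((2 * pi)\<^sup>2 / (A * B - c\<^sup>2))"
      using A by (simp add: A'_def power2_eq_square flip: real_sqrt_mult)
    then show ?thesis by (simp only: real_sqrt_divide real_sqrt_abs) simp
  qed
  have e2: "- x\<^sup>2 / (2 * A) + - y\<^sup>2 / (2 * A') = - x\<^sup>2 * (A + B - 2 * c) / (2 * (A * B - c\<^sup>2))"
  proof -
    have "A * B - c\<^sup>2 \<noteq> 0" using D by simp
    then have "1 / A + (1 - c / A)\<^sup>2 / A' = (A + B - 2 * c) / (A * B - c\<^sup>2)"
      using A D unfolding A'_def
      by (simp add: divide_simps) (simp add: power2_eq_square algebra_simps)
    moreover have "- x\<^sup>2 / (2 * A) + - y\<^sup>2 / (2 * A') = - (x\<^sup>2 / 2) * (1 / A + (1 - c / A)\<^sup>2 / A')"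
      by (simp add: y_def power_mult_distrib distrib_left)
    ultimately show ?thesis
      by simp
  qed
  have "(LINT v|lborel. LINT u|lborel.
            exp (- (A * u\<^sup>2 + 2 * c * u * v + B * v\<^sup>2) / 2) *\<^sub>R iexp (- x * (u + v)))
     = complex_of_real (sqrt (2 * pi / A) * exp (- x\<^sup>2 / (2 * A))) * (LINT v|lborel. exp (- A' * v\<^sup>2 / 2) *\<^sub>R iexp (y * v))"
    unfolding inner by (rule integral_mult_right_zero)
  also have "\<dots> = complex_of_real (sqrt (2 * pi / A) * sqrt (2 * pi / A') * exp (- x\<^sup>2 / (2 * A) + - y\<^sup>2 / (2 * A')))"
    unfolding gaussian_fourier[OF A'] exp_add by simp
  finally show ?thesis
    unfolding e1 e2 .
qed

text \<open>The right-hand side is the density at \<open>(x, x)\<close> of the centred Gaussian law with covariance matrix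
  \<open>A c; c B\<close>, the law of the pair with independent noise of variances \<open>\<epsilon>\<close> and \<open>\<delta>\<close> added. The
  hypothesis controls the laws of linear combinations only, so the route goes through the Fourier
  side: writing both kernels as Fourier integrals turns the expectation into a characteristic
  function of such a combination.\<close>

lemma (in prob_space) gaussian_pair_smoothing:
  fixes Y Z :: "'a \<Rightarrow> real"
  assumes G: "\<And>u v. gaussian_rv M (\<lambda>\<omega>. u * Y \<omega> + v * Z \<omega>)"
    and mY: "(\<integral>\<omega>. Y \<omega> \<partial>M) = 0" and mZ: "(\<integral>\<omega>. Z \<omega> \<partial>M) = 0"
    and eps: "\<epsilon> > 0" "\<delta> > 0"
  defines "A \<equiv> (\<integral>\<omega>. (Y \<omega>)\<^sup>2 \<partial>M) + \<epsilon>" and "B \<equiv> (\<integral>\<omega>. (Z \<omega>)\<^sup>2 \<partial>M) + \<delta>"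
    and "c \<equiv> (\<integral>\<omega>. Y \<omega> * Z \<omega> \<partial>M)"
  assumes D: "A * B - c\<^sup>2 > 0"
  shows "(\<integral>\<omega>. normal_density 0 (sqrt \<epsilon>) (Y \<omega> - x) * normal_density 0 (sqrt \<delta>) (Z \<omega> - x) \<partial>M)
       = exp (- x\<^sup>2 * (A + B - 2 * c) / (2 * (A * B - c\<^sup>2))) / (2 * pi * sqrt (A * B - c\<^sup>2))"
proof -
  have sqY: "square_integrable M Y" and sqZ: "square_integrable M Z"
    using gaussian_rv_square_integrable[OF G[of 1 0]] gaussian_rv_square_integrable[OF G[of 0 1]] by auto
  note [measurable] = sqY[THEN square_integrable_borel] sqZ[THEN square_integrable_borel]
  have A: "A > 0" using eps by (simp add: A_def add_nonneg_pos)
  have char: "(\<integral>\<omega>. iexp ((Y \<omega> - x) * u) * iexp ((Z \<omega> - x) * v) \<partial>M)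
      = exp (- ((A - \<epsilon>) * u\<^sup>2 + 2 * c * u * v + (B - \<delta>) * v\<^sup>2) / 2) *\<^sub>R iexp (- x * (u + v))" for u v
  proof -
    have "(\<integral>\<omega>. u * Y \<omega> + v * Z \<omega> \<partial>M) = 0"
      using square_integrable_integrable[OF sqY] square_integrable_integrable[OF sqZ] mY mZ by simp
    moreover have "(\<integral>\<omega>. (u * Y \<omega> + v * Z \<omega>)\<^sup>2 \<partial>M) = (A - \<epsilon>) * u\<^sup>2 + 2 * c * u * v + (B - \<delta>) * v\<^sup>2"
    proof -
      have "(\<integral>\<omega>. (u * Y \<omega> + v * Z \<omega>)\<^sup>2 \<partial>M) = (\<integral>\<omega>. u\<^sup>2 * (Y \<omega>)\<^sup>2 + (v\<^sup>2 * (Z \<omega>)\<^sup>2 + 2 * u * v * (Y \<omega> * Z \<omega>)) \<partial>M)"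
        by (intro Bochner_Integration.integral_cong refl) (simp add: power2_eq_square algebra_simps)
      also have "\<dots> = u\<^sup>2 * (A - \<epsilon>) + (v\<^sup>2 * (B - \<delta>) + 2 * u * v * c)"
        using sqY sqZ square_integrable_mult[OF sqY sqZ]
        by (simp add: square_integrable_def A_def B_def c_def)
      finally show ?thesis by simp
    qed
    ultimately have ch: "(\<integral>\<omega>. iexp (u * Y \<omega> + v * Z \<omega>) \<partial>M) = complex_of_real (exp (- ((A - \<epsilon>) * u\<^sup>2 + 2 * c * u * v + (B - \<delta>) * v\<^sup>2) / 2))"
      using gaussian_rv_char[OF G[of u v]] by simp
    have "iexp ((Y \<omega> - x) * u) * iexp ((Z \<omega> - x) * v) = iexp (- x * (u + v)) * iexp (u * Y \<omega> + v * Z \<omega>)" for \<omega>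
      by (simp add: algebra_simps flip: exp_add)
    then have "(\<integral>\<omega>. iexp ((Y \<omega> - x) * u) * iexp ((Z \<omega> - x) * v) \<partial>M) = iexp (- x * (u + v)) * (\<integral>\<omega>. iexp (u * Y \<omega> + v * Z \<omega>) \<partial>M)"
      by (simp only: integral_mult_right_zero)
    then show ?thesis
      unfolding ch by (simp add: scaleR_conv_of_real)
  qed
  have "complex_of_real (\<integral>\<omega>. normal_density 0 (sqrt \<epsilon>) (Y \<omega> - x) * normal_density 0 (sqrt \<delta>) (Z \<omega> - x) \<partial>M)
      = (\<integral>\<omega>. normal_density 0 (sqrt \<delta>) (Z \<omega> - x) *\<^sub>R complex_of_real (normal_density 0 (sqrt \<epsilon>) (Y \<omega> - x)) \<partial>M)"
    by (subst integral_complex_of_real[symmetric]) (simp add: scaleR_conv_of_real mult.commute)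
  also have "\<dots> = (1 / (2 * pi)) *\<^sub>R (LINT v|lborel. exp (- \<delta> * v\<^sup>2 / 2) *\<^sub>R
       (\<integral>\<omega>. iexp ((Z \<omega> - x) * v) * complex_of_real (normal_density 0 (sqrt \<epsilon>) (Y \<omega> - x)) \<partial>M))"
    using eps normal_density_le[OF eps(1)]
    by (intro normal_density_expectation_fourier[where K = "1 / sqrt (2 * pi * \<epsilon>)"]) auto
  also have "\<dots> = (1 / (2 * pi)) *\<^sub>R (LINT v|lborel. exp (- \<delta> * v\<^sup>2 / 2) *\<^sub>R ((1 / (2 * pi)) *\<^sub>R
       (LINT u|lborel. exp (- \<epsilon> * u\<^sup>2 / 2) *\<^sub>R (\<integral>\<omega>. iexp ((Y \<omega> - x) * u) * iexp ((Z \<omega> - x) * v) \<partial>M))))"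
  proof -
    have "(\<integral>\<omega>. iexp ((Z \<omega> - x) * v) * complex_of_real (normal_density 0 (sqrt \<epsilon>) (Y \<omega> - x)) \<partial>M)
      = (1 / (2 * pi)) *\<^sub>R (LINT u|lborel. exp (- \<epsilon> * u\<^sup>2 / 2) *\<^sub>R (\<integral>\<omega>. iexp ((Y \<omega> - x) * u) * iexp ((Z \<omega> - x) * v) \<partial>M))" for v
    proof -
      have "(\<integral>\<omega>. iexp ((Z \<omega> - x) * v) * complex_of_real (normal_density 0 (sqrt \<epsilon>) (Y \<omega> - x)) \<partial>M)
          = (\<integral>\<omega>. normal_density 0 (sqrt \<epsilon>) (Y \<omega> - x) *\<^sub>R iexp ((Z \<omega> - x) * v) \<partial>M)"
        by (simp add: scaleR_conv_of_real mult.commute)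
      also have "\<dots> = (1 / (2 * pi)) *\<^sub>R (LINT u|lborel. exp (- \<epsilon> * u\<^sup>2 / 2) *\<^sub>R (\<integral>\<omega>. iexp ((Y \<omega> - x) * u) * iexp ((Z \<omega> - x) * v) \<partial>M))"
        using eps by (intro normal_density_expectation_fourier[where K = 1]) auto
      finally show ?thesis .
    qed
    then show ?thesis by simp
  qed
  also have "\<dots> = (1 / (2 * pi)\<^sup>2) *\<^sub>R (LINT v|lborel. LINT u|lborel.
       exp (- (A * u\<^sup>2 + 2 * c * u * v + B * v\<^sup>2) / 2) *\<^sub>R iexp (- x * (u + v)))"
  proof -
    have "exp (- \<delta> * v\<^sup>2 / 2) *\<^sub>R ((1 / (2 * pi)) *\<^sub>R
       (LINT u|lborel. exp (- \<epsilon> * u\<^sup>2 / 2) *\<^sub>R (exp (- ((A - \<epsilon>) * u\<^sup>2 + 2 * c * u * v + (B - \<delta>) * v\<^sup>2) / 2) *\<^sub>R iexp (- x * (u + v)))))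
      = (1 / (2 * pi)) *\<^sub>R (LINT u|lborel. exp (- (A * u\<^sup>2 + 2 * c * u * v + B * v\<^sup>2) / 2) *\<^sub>R iexp (- x * (u + v)))" for v
    proof -
      have "exp (- \<delta> * v\<^sup>2 / 2) * exp (- \<epsilon> * u\<^sup>2 / 2) * exp (- ((A - \<epsilon>) * u\<^sup>2 + 2 * c * u * v + (B - \<delta>) * v\<^sup>2) / 2)
          = exp (- (A * u\<^sup>2 + 2 * c * u * v + B * v\<^sup>2) / 2)" for u
        unfolding exp_add[symmetric] by (rule arg_cong[where f = exp]) (simp add: field_simps)
      then have "exp (- \<delta> * v\<^sup>2 / 2) *\<^sub>R (exp (- \<epsilon> * u\<^sup>2 / 2) *\<^sub>R (exp (- ((A - \<epsilon>) * u\<^sup>2 + 2 * c * u * v + (B - \<delta>) * v\<^sup>2) / 2) *\<^sub>R iexp (- x * (u + v))))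
          = exp (- (A * u\<^sup>2 + 2 * c * u * v + B * v\<^sup>2) / 2) *\<^sub>R iexp (- x * (u + v))" for u
        by (simp only: scaleR_scaleR mult.assoc[symmetric])
      then show ?thesis
        by (subst scaleR_left_commute, subst integral_scaleR_right[symmetric]) simp
    qed
    then show ?thesis
      unfolding char by (simp only: integral_scaleR_right scaleR_scaleR) (simp add: power2_eq_square)
  qed
  also have "\<dots> = complex_of_real (exp (- x\<^sup>2 * (A + B - 2 * c) / (2 * (A * B - c\<^sup>2))) / (2 * pi * sqrt (A * B - c\<^sup>2)))"
    unfolding bivariate_gaussian_fourier[OF A D] by (simp add: scaleR_conv_of_real power2_eq_square)
  finally show ?thesis
    by (simp only: of_real_eq_iff)
qed

section \<open>Conditional variance and linear prediction\<close>

text \<open>The conditional expectation is the best predictor in \<open>L\<^sup>2\<close>. Its mean square error, the mean of the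
  conditional variance, is therefore at most the mean square error of any linear predictor. This
  turns a bound on the conditional variance into a bound on the covariances.\<close>

lemma (in prob_space) cond_variance_lower_bound:
  assumes Y: "square_integrable M Y" and Z: "square_integrable M Z"
    and lower: "AE \<omega> in M. K \<le> cond_variance M Y Z \<omega>"
  shows "K \<le> (\<integral>\<omega>. (Y \<omega> - \<beta> * Z \<omega>)\<^sup>2 \<partial>M)"
proof -
  note [measurable] = Y[THEN square_integrable_borel] Z[THEN square_integrable_borel]
  define G where "G = vimage_algebra (space M) Z borel"
  have "subalgebra M G"
    unfolding subalgebra_def G_def by (intro conjI sets_image_in_sets) (simp, rule refl, measurable)
  then interpret finite_measure_subalgebra M G
    by unfold_locales
  have Z_G: "(\<lambda>\<omega>. \<beta> * Z \<omega>) \<in> borel_measurable G"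
    unfolding G_def by (intro borel_measurable_times borel_measurable_const measurable_vimage_algebra1) auto
  define W where "W \<omega> = Y \<omega> - \<beta> * Z \<omega>" for \<omega>
  define m where "m = real_cond_exp M G W"
  have W: "square_integrable M W"
    unfolding W_def by (intro square_integrable_diff square_integrable_cmult Y Z)
  note [measurable] = W[THEN square_integrable_borel]
  have W2: "integrable M (\<lambda>\<omega>. (W \<omega>)\<^sup>2)"
    using W by (simp add: square_integrable_def)
  have [measurable]: "m \<in> borel_measurable M"
    unfolding m_def by (rule borel_measurable_cond_exp2)
  have m_G: "m \<in> borel_measurable G"
    unfolding m_def by (rule borel_measurable_cond_exp)
  \<comment> \<open>Conditioning contracts the \<open>L\<^sup>2\<close> norm, so the products below are integrable.\<close>
  have jensen: "AE \<omega> in M. (m \<omega>)\<^sup>2 \<le> real_cond_exp M G (\<lambda>\<omega>. (W \<omega>)\<^sup>2) \<omega>"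
    unfolding m_def
    by (rule real_cond_exp_jensens_inequality(2)[of W UNIV 0 0 power2])
      (auto intro!: square_integrable_integrable W convex_power2 W2)
  have "integrable M (\<lambda>\<omega>. (m \<omega>)\<^sup>2)"
    by (rule Bochner_Integration.integrable_bound[OF real_cond_exp_int(1)[OF W2]])
      (use jensen in auto)
  then have m: "square_integrable M m"
    by (simp add: square_integrable_def)
  have mm: "(\<integral>\<omega>. m \<omega> * m \<omega> \<partial>M) = (\<integral>\<omega>. m \<omega> * W \<omega> \<partial>M)"
    using real_cond_exp_intg(2)[OF square_integrable_mult[OF m W] m_G] by (simp add: m_def)
  have "AE \<omega> in M. m \<omega> = real_cond_exp M G Y \<omega> - real_cond_exp M G (\<lambda>\<omega>. \<beta> * Z \<omega>) \<omega>"
    unfolding m_def W_def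
    by (intro real_cond_exp_diff square_integrable_integrable Y square_integrable_cmult Z)
  moreover have "AE \<omega> in M. real_cond_exp M G (\<lambda>\<omega>. \<beta> * Z \<omega>) \<omega> = \<beta> * Z \<omega>"
    by (intro real_cond_exp_F_meas square_integrable_integrable square_integrable_cmult Z Z_G)
  ultimately have res: "AE \<omega> in M. (Y \<omega> - real_cond_exp M G Y \<omega>)\<^sup>2 = (W \<omega> - m \<omega>)\<^sup>2"
    by eventually_elim (simp add: W_def)
  have Wm: "integrable M (\<lambda>\<omega>. (W \<omega> - m \<omega>)\<^sup>2)"
    using square_integrable_diff[OF W m] by (simp add: square_integrable_def)
  also have "?this \<longleftrightarrow> integrable M (\<lambda>\<omega>. (Y \<omega> - real_cond_exp M G Y \<omega>)\<^sup>2)"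
    using res by (intro integrable_cong_AE) auto
  finally have int: "integrable M (\<lambda>\<omega>. (Y \<omega> - real_cond_exp M G Y \<omega>)\<^sup>2)" .
  have "K = (\<integral>\<omega>. K \<partial>M)"
    by (simp add: prob_space)
  also have "\<dots> \<le> (\<integral>\<omega>. cond_variance M Y Z \<omega> \<partial>M)"
    using lower unfolding cond_variance_def Let_def G_def[symmetric]
    by (intro integral_mono_AE real_cond_exp_int int) auto
  also have "\<dots> = (\<integral>\<omega>. (Y \<omega> - real_cond_exp M G Y \<omega>)\<^sup>2 \<partial>M)"
    unfolding cond_variance_def Let_def G_def[symmetric] by (intro real_cond_exp_int int)
  also have "\<dots> = (\<integral>\<omega>. (W \<omega> - m \<omega>)\<^sup>2 \<partial>M)"
    using res by (intro integral_cong_AE) auto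
  also have "\<dots> = (\<integral>\<omega>. (W \<omega>)\<^sup>2 - 2 * (m \<omega> * W \<omega>) + m \<omega> * m \<omega> \<partial>M)"
    by (simp add: power2_eq_square algebra_simps)
  also have "\<dots> = (\<integral>\<omega>. (W \<omega>)\<^sup>2 \<partial>M) - (\<integral>\<omega>. (m \<omega>)\<^sup>2 \<partial>M)"
    using W2 square_integrable_mult[OF m W] square_integrable_mult[OF m m] mm
    by (simp add: power2_eq_square)
  also have "\<dots> \<le> (\<integral>\<omega>. (W \<omega>)\<^sup>2 \<partial>M)"
    by simp
  finally show ?thesis
    by (simp add: W_def)
qed

section \<open>Lebesgue measure on the unit cube\<close>

abbreviation cube_measure :: "(real ^ 'n) measure" where
  "cube_measure \<equiv> restrict_space lborel unit_cube"

abbreviation cube_pair_measure :: "((real ^ 'n) \<times> (real ^ 'n)) measure" where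
  "cube_pair_measure \<equiv> cube_measure \<Otimes>\<^sub>M cube_measure"

lemma mem_unit_cube: "t \<in> unit_cube \<longleftrightarrow> (\<forall>j. 0 \<le> t $ j \<and> t $ j \<le> 1)"
  by (simp add: mem_box_cart)

lemma nn_integral_lborel_prod_cart:
  fixes f :: "'n::finite \<Rightarrow> real \<Rightarrow> ennreal"
  assumes [measurable]: "\<And>j. f j \<in> borel_measurable borel"
  shows "(\<integral>\<^sup>+x. (\<Prod>j\<in>UNIV. f j (x $ j)) \<partial>lborel) = (\<Prod>j\<in>UNIV. \<integral>\<^sup>+u. f j u \<partial>lborel)"
proof -
  have Basis: "(Basis :: (real ^ 'n) set) = range (\<lambda>j. axis j 1)"
    by (auto simp: Basis_vec_def)
  have inj: "inj (\<lambda>j::'n. axis j (1::real))"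
    by (auto simp: inj_on_def axis_eq_axis)
  have "(\<integral>\<^sup>+x. (\<Prod>b\<in>(Basis :: (real ^ 'n) set). f (axis_index b) (x \<bullet> b)) \<partial>lborel)
      = (\<Prod>b\<in>(Basis :: (real ^ 'n) set). \<integral>\<^sup>+u. f (axis_index b) u \<partial>lborel)"
    by (rule nn_integral_lborel_prod) auto
  then show ?thesis
    unfolding Basis prod.reindex[OF inj] by (simp add: comp_def flip: cart_eq_inner_axis)
qed

lemma emeasure_lborel_cbox_cart:
  fixes l u :: "real ^ 'n"
  assumes "\<And>j. l $ j \<le> u $ j"
  shows "emeasure lborel (cbox l u) = ennreal (\<Prod>j\<in>UNIV. u $ j - l $ j)"
proof -
  have "indicator (cbox l u) x = (\<Prod>j\<in>UNIV. indicator {l $ j..u $ j} (x $ j) :: ennreal)" for x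
    by (auto simp: indicator_def mem_box_cart prod_zero_iff)
  then have "emeasure lborel (cbox l u) = (\<integral>\<^sup>+x. (\<Prod>j\<in>UNIV. indicator {l $ j..u $ j} (x $ j)) \<partial>lborel)"
    by (simp flip: nn_integral_indicator)
  also have "\<dots> = (\<Prod>j\<in>UNIV. ennreal (u $ j - l $ j))"
    using assms by (subst nn_integral_lborel_prod_cart) auto
  finally show ?thesis
    using assms by (simp add: prod_ennreal)
qed

lemma prob_space_cube_measure: "prob_space (cube_measure :: (real ^ 'n) measure)"
proof (rule prob_spaceI)
  have "emeasure lborel (unit_cube :: (real ^ 'n) set) = 1"
    by (subst emeasure_lborel_cbox_cart) auto
  then show "emeasure cube_measure (space (cube_measure :: (real ^ 'n) measure)) = 1"
    by (simp add: space_restrict_space emeasure_restrict_space)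
qed

lemma space_cube_measure: "space cube_measure = unit_cube"
  by (simp add: space_restrict_space)

lemma measurable_on_cube_measure_pair:
  fixes f :: "(real ^ 'n) \<times> (real ^ 'n) \<Rightarrow> real"
  assumes "continuous_on (unit_cube \<times> unit_cube) f"
  shows "f \<in> borel_measurable (cube_pair_measure)"
proof -
  have "(\<lambda>p. p) \<in> cube_pair_measure \<rightarrow>\<^sub>M restrict_space borel ((unit_cube :: (real ^ 'n) set) \<times> unit_cube)"
  proof (rule measurable_restrict_space2)
    show "(\<lambda>p. p) \<in> space cube_pair_measure \<rightarrow> (unit_cube :: (real ^ 'n) set) \<times> unit_cube"
      by (auto simp: space_pair_measure space_cube_measure)
    have [measurable]: "(\<lambda>s. s) \<in> cube_measure \<rightarrow>\<^sub>M borel"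
      by (rule measurable_restrict_space1) simp
    show "(\<lambda>p. p) \<in> cube_pair_measure \<rightarrow>\<^sub>M (borel :: ((real ^ 'n) \<times> (real ^ 'n)) measure)"
      unfolding borel_prod[symmetric]
      using measurable_Pair[OF measurable_compose[OF measurable_fst] measurable_compose[OF measurable_snd],
          of "\<lambda>s. s" cube_measure borel "\<lambda>s. s" cube_measure borel] by simp
  qed
  from measurable_compose[OF this borel_measurable_continuous_on_restrict[OF assms]]
  show ?thesis by simp
qed

section \<open>Covariance functions with anisotropic increments\<close>

text \<open>For \<open>x \<in> \<real>\<^sup>d\<close> with \<open>q = \<parallel>x\<parallel>\<^sup>2\<close> this is the density at \<open>(x, x)\<close> of \<open>d\<close> independent centred Gaussian pairs,
  each with covariance matrix \<open>A c; c B\<close>: on the diagonal the quadratic form of the inverse matrix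
  depends on \<open>x\<close> through its norm only.\<close>

definition diag_density :: "nat \<Rightarrow> real \<Rightarrow> real \<Rightarrow> real \<Rightarrow> real \<Rightarrow> real" where
  "diag_density d q A B c =
     exp (- q * (A + B - 2 * c) / (2 * (A * B - c\<^sup>2))) / (2 * pi * sqrt (A * B - c\<^sup>2)) ^ d"

text \<open>With \<open>V\<close> the sum on the left, \<open>u\<^sub>j \<le> V powr (1 / (2 H\<^sub>j))\<close> for every \<open>j\<close>, and the exponents multiply
  up to \<open>V powr (- d / 2)\<close> by the choice of \<open>\<theta>\<close>. All coordinates on the right carry the same exponent,
  and \<open>\<theta> < 1\<close>, the condition for integrability in one dimension, says exactly that
  \<open>\<Sum>1 / H\<^sub>j > d\<close>.\<close>

lemma sum_powr_le_prod_powr: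
  fixes u H :: "'n::finite \<Rightarrow> real"
  assumes u: "\<And>j. u j > 0" and H: "\<And>j. H j > 0" and "d \<ge> 0"
    and \<theta>: "\<theta> * (\<Sum>j\<in>UNIV. 1 / H j) = d"
  shows "(\<Sum>j\<in>UNIV. u j powr (2 * H j)) powr (- d / 2) \<le> (\<Prod>j\<in>UNIV. u j powr - \<theta>)"
proof -
  define V where "V = (\<Sum>j\<in>UNIV. u j powr (2 * H j))"
  have Q: "(\<Sum>j\<in>UNIV. 1 / H j) > 0"
    using H by (intro sum_pos) auto
  then have "\<theta> \<ge> 0"
    using \<theta> \<open>d \<ge> 0\<close> by (metis mult_less_0_iff not_less order_less_imp_le)
  have "V > 0"
    unfolding V_def using u by (intro sum_pos) (auto simp: powr_gt_zero less_le)
  have "- d / 2 = (\<Sum>j\<in>UNIV. 1 / (2 * H j) * - \<theta>)"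
  proof -
    have "(\<Sum>j\<in>UNIV. 1 / (2 * H j) * - \<theta>) = (\<Sum>j\<in>UNIV. (- \<theta> / 2) * (1 / H j))"
      by (intro sum.cong refl) (simp add: field_simps)
    also have "\<dots> = (- \<theta> / 2) * (\<Sum>j\<in>UNIV. 1 / H j)"
      by (rule sum_distrib_left[symmetric])
    finally show ?thesis using \<theta> by simp
  qed
  then have "V powr (- d / 2) = (\<Prod>j\<in>UNIV. V powr (1 / (2 * H j) * - \<theta>))"
    using \<open>V > 0\<close> by (simp only: powr_sum)
  also have "\<dots> \<le> (\<Prod>j\<in>UNIV. u j powr - \<theta>)"
  proof (intro prod_mono conjI)
    fix j
    have "u j powr (2 * H j) \<le> V"
      unfolding V_def by (rule member_le_sum) auto
    then have "(u j powr (2 * H j)) powr (1 / (2 * H j)) \<le> V powr (1 / (2 * H j))"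
      using H[of j] by (intro powr_mono2) auto
    then have "u j \<le> V powr (1 / (2 * H j))"
      using H[of j] u[of j] by (simp add: powr_powr)
    then have "(V powr (1 / (2 * H j))) powr - \<theta> \<le> u j powr - \<theta>"
      using u[of j] \<open>\<theta> \<ge> 0\<close> by (intro powr_mono2') auto
    then show "V powr (1 / (2 * H j) * - \<theta>) \<le> u j powr - \<theta>"
      by (simp only: powr_powr)
  qed simp
  finally show ?thesis
    unfolding V_def .
qed

lemma nn_integral_abs_powr_finite:
  assumes "0 \<le> \<theta>" "\<theta> < 1"
  shows "(\<integral>\<^sup>+u. ennreal (\<bar>u\<bar> powr - \<theta>) * indicator {-1..1} u \<partial>lborel) < \<infinity>"
proof -
  have "((\<lambda>u. u powr - \<theta>) has_integral (1 powr (- \<theta> + 1) / (- \<theta> + 1))) {0..1}"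
    using assms by (intro has_integral_powr_from_0) auto
  then have half: "(\<integral>\<^sup>+u. ennreal (u powr - \<theta>) * indicator {0..1} u \<partial>lborel) = ennreal (1 / (1 - \<theta>))"
    by (subst nn_integral_has_integral_lebesgue') simp_all
  have "(\<integral>\<^sup>+u. ennreal (\<bar>u\<bar> powr - \<theta>) * indicator {-1..1} u \<partial>lborel)
     \<le> (\<integral>\<^sup>+u. ennreal (u powr - \<theta>) * indicator {0..1} u + ennreal ((- u) powr - \<theta>) * indicator {0..1} (- u) \<partial>lborel)"
    by (intro nn_integral_mono) (auto simp: indicator_def abs_if)
  also have "\<dots> = (\<integral>\<^sup>+u. ennreal (u powr - \<theta>) * indicator {0..1} u \<partial>lborel)
      + (\<integral>\<^sup>+u. ennreal ((- u) powr - \<theta>) * indicator {0..1} (- u) \<partial>lborel)"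
    by (rule nn_integral_add) auto
  also have "(\<integral>\<^sup>+u. ennreal ((- u) powr - \<theta>) * indicator {0..1} (- u) \<partial>lborel) = (\<integral>\<^sup>+u. ennreal (u powr - \<theta>) * indicator {0..1} u \<partial>lborel)"
    by (subst nn_integral_real_affine[where c = "-1" and t = 0]) auto
  finally show ?thesis
    unfolding half by (rule le_less_trans) (simp add: ennreal_add_less_top)
qed

text \<open>The properties of the covariance function on which the analysis rests. The lower bound is the
  condition on conditional variances in terms of the mean square error of the linear predictor with
  coefficient \<open>\<beta>\<close>.\<close>

locale anisotropic_covariance =
  fixes R :: "real ^ 'n \<Rightarrow> real ^ 'n \<Rightarrow> real" and H :: "real ^ 'n" and c1 c2 :: real
  assumes H_pos: "0 < H $ j" and H_less: "H $ j < 1"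
    and c1_pos: "0 < c1" and c2_pos: "0 < c2"
    and R_cont: "continuous_on (unit_cube \<times> unit_cube) (\<lambda>(s, t). R s t)"
    and R_upper: "s \<in> unit_cube \<Longrightarrow> t \<in> unit_cube \<Longrightarrow>
      R s s + R t t - 2 * R s t \<le> c1 * (\<Sum>j\<in>UNIV. \<bar>s $ j - t $ j\<bar> powr (2 * H $ j))"
    and R_lower: "s \<in> unit_cube \<Longrightarrow> t \<in> unit_cube \<Longrightarrow>
      c2 * (\<Sum>j\<in>UNIV. min (\<bar>s $ j - t $ j\<bar> powr (2 * H $ j)) (\<bar>t $ j\<bar> powr (2 * H $ j)))
        \<le> R t t - 2 * \<beta> * R s t + \<beta>\<^sup>2 * R s s"
begin

definition R_det :: "real ^ 'n \<Rightarrow> real ^ 'n \<Rightarrow> real" where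
  "R_det s t = R s s * R t t - (R s t)\<^sup>2"

definition second_moment_kernel :: "nat \<Rightarrow> real \<Rightarrow> real \<Rightarrow> real \<Rightarrow> (real ^ 'n) \<times> (real ^ 'n) \<Rightarrow> real" where
  "second_moment_kernel d q \<epsilon> \<delta> = (\<lambda>(s, t). diag_density d q (R s s + \<epsilon>) (R t t + \<delta>) (R s t))"

lemma quad_form_nonneg:
  assumes "s \<in> unit_cube" "t \<in> unit_cube"
  shows "0 \<le> R t t - 2 * \<beta> * R s t + \<beta>\<^sup>2 * R s s"
proof -
  have "0 \<le> c2 * (\<Sum>j\<in>UNIV. min (\<bar>s $ j - t $ j\<bar> powr (2 * H $ j)) (\<bar>t $ j\<bar> powr (2 * H $ j)))"
    using c2_pos by (intro mult_nonneg_nonneg sum_nonneg) auto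
  then show ?thesis
    using R_lower[OF assms] by (rule order_trans)
qed

lemma R_diag_nonneg: "t \<in> unit_cube \<Longrightarrow> 0 \<le> R t t"
  using quad_form_nonneg[of t t 0] by simp

lemma R_diag_lower:
  assumes "t \<in> unit_cube"
  shows "c2 * (\<Sum>j\<in>UNIV. \<bar>t $ j\<bar> powr (2 * H $ j)) \<le> R t t"
  using R_lower[of 0 t 0] assms by (simp add: mem_box_cart)

text \<open>The choice \<open>\<beta> = R s t / R s s\<close>, the regression coefficient, minimises the prediction error, and
  the minimum is \<open>R_det s t / R s s\<close>. If \<open>R s s = 0\<close> the error is affine in \<open>\<beta>\<close>; being bounded
  below, it is constant, so \<open>R s t = 0\<close>.\<close>

lemma R_det_lower:
  assumes s: "s \<in> unit_cube" and t: "t \<in> unit_cube"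
  shows "c2 * R s s * (\<Sum>j\<in>UNIV. min (\<bar>s $ j - t $ j\<bar> powr (2 * H $ j)) (\<bar>t $ j\<bar> powr (2 * H $ j))) \<le> R_det s t"
proof (cases "R s s = 0")
  case True
  have "R s t = 0"
  proof (rule ccontr)
    assume "R s t \<noteq> 0"
    then show False
      using quad_form_nonneg[OF s t, of "(R t t + 1) / (2 * R s t)"] True by simp
  qed
  then show ?thesis
    using True by (simp add: R_det_def)
next
  case False
  then have pos: "R s s > 0"
    using R_diag_nonneg[OF s] by simp
  let ?k = "\<Sum>j\<in>UNIV. min (\<bar>s $ j - t $ j\<bar> powr (2 * H $ j)) (\<bar>t $ j\<bar> powr (2 * H $ j))"
  have "c2 * ?k \<le> R t t - 2 * (R s t / R s s) * R s t + (R s t / R s s)\<^sup>2 * R s s"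
    by (rule R_lower[OF s t])
  also have "\<dots> = R_det s t / R s s"
    using pos by (simp add: R_det_def power2_eq_square field_simps)
  finally show ?thesis
    using pos by (simp add: field_simps)
qed

lemma R_det_nonneg:
  assumes s: "s \<in> unit_cube" and t: "t \<in> unit_cube"
  shows "0 \<le> R_det s t"
proof -
  have "0 \<le> c2 * R s s * (\<Sum>j\<in>UNIV. min (\<bar>s $ j - t $ j\<bar> powr (2 * H $ j)) (\<bar>t $ j\<bar> powr (2 * H $ j)))"
    using c2_pos R_diag_nonneg[OF s] by (intro mult_nonneg_nonneg sum_nonneg) auto
  then show ?thesis
    using R_det_lower[OF s t] by simp
qed

lemma R_det_upper: "R_det s t \<le> R s s * (R s s + R t t - 2 * R s t)"
proof -
  have "R s s * (R s s + R t t - 2 * R s t) - R_det s t = (R s s - R s t)\<^sup>2"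
    by (simp add: R_det_def power2_eq_square algebra_simps)
  then show ?thesis
    using zero_le_power2[of "R s s - R s t"] by linarith
qed

lemma shifted_det:
  "(R s s + \<epsilon>) * (R t t + \<delta>) - (R s t)\<^sup>2 = R_det s t + \<epsilon> * R t t + \<delta> * R s s + \<epsilon> * \<delta>"
  by (simp add: R_det_def algebra_simps)

lemma shifted_det_lower:
  assumes "s \<in> unit_cube" "t \<in> unit_cube" "\<epsilon> \<ge> 0" "\<delta> \<ge> 0"
  shows "R_det s t + \<epsilon> * \<delta> \<le> (R s s + \<epsilon>) * (R t t + \<delta>) - (R s t)\<^sup>2"
  unfolding shifted_det using R_diag_nonneg assms by simp

lemma second_moment_kernel_nonneg:
  assumes "s \<in> unit_cube" "t \<in> unit_cube" "\<epsilon> \<ge> 0" "\<delta> \<ge> 0"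
  shows "0 \<le> second_moment_kernel d q \<epsilon> \<delta> (s, t)"
proof -
  have "0 \<le> (R s s + \<epsilon>) * (R t t + \<delta>) - (R s t)\<^sup>2"
    using shifted_det_lower[OF assms] R_det_nonneg[OF assms(1,2)] mult_nonneg_nonneg[OF assms(3,4)] by linarith
  then show ?thesis
    unfolding second_moment_kernel_def diag_density_def case_prod_conv
    by (intro divide_nonneg_nonneg zero_le_power mult_nonneg_nonneg) auto
qed

text \<open>Regularisation only increases the determinant, which makes the bound uniform in the two
  parameters: any lower bound for the unregularised determinant can be used for \<open>m\<close>, and so can
  \<open>\<epsilon> * \<delta>\<close> itself.\<close>

lemma second_moment_kernel_upper:
  assumes st: "s \<in> unit_cube" "t \<in> unit_cube" and eps: "\<epsilon> \<ge> 0" "\<delta> \<ge> 0" and q: "q \<ge> 0"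
    and m: "0 < m" "m \<le> R_det s t + \<epsilon> * \<delta>"
  shows "second_moment_kernel d q \<epsilon> \<delta> (s, t) \<le> 1 / (2 * pi * sqrt m) ^ d"
proof -
  let ?D = "(R s s + \<epsilon>) * (R t t + \<delta>) - (R s t)\<^sup>2"
  have D: "m \<le> ?D"
    using shifted_det_lower[OF st eps] m by linarith
  have "0 \<le> q * ((R s s + \<epsilon>) + (R t t + \<delta>) - 2 * R s t) / (2 * ?D)"
    using quad_form_nonneg[OF st, of 1] D m q eps by (intro divide_nonneg_nonneg mult_nonneg_nonneg) auto
  then have "exp (- q * ((R s s + \<epsilon>) + (R t t + \<delta>) - 2 * R s t) / (2 * ?D)) \<le> 1"
    by simp
  moreover have "(2 * pi * sqrt m) ^ d \<le> (2 * pi * sqrt ?D) ^ d"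
    using m D by (intro power_mono mult_left_mono) auto
  ultimately show ?thesis
    unfolding second_moment_kernel_def diag_density_def case_prod_conv
    using m by (intro frac_le) auto
qed

lemma R_measurable:
  "(\<lambda>p. R (fst p) (snd p)) \<in> borel_measurable cube_pair_measure"
  "(\<lambda>p. R (fst p) (fst p)) \<in> borel_measurable cube_pair_measure"
  "(\<lambda>p. R (snd p) (snd p)) \<in> borel_measurable cube_pair_measure"
proof -
  have *: "continuous_on (unit_cube \<times> unit_cube) (\<lambda>p. R (f p) (g p))"
    if "continuous_on (unit_cube \<times> unit_cube) f" "continuous_on (unit_cube \<times> unit_cube) g"
      "f ` (unit_cube \<times> unit_cube) \<subseteq> unit_cube" "g ` (unit_cube \<times> unit_cube) \<subseteq> unit_cube"
    for f g :: "(real ^ 'n) \<times> (real ^ 'n) \<Rightarrow> real ^ 'n"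
  proof -
    have "continuous_on (unit_cube \<times> unit_cube) ((\<lambda>(s, t). R s t) \<circ> (\<lambda>p. (f p, g p)))"
      using that by (intro continuous_on_compose continuous_on_Pair) (auto intro!: continuous_on_subset[OF R_cont])
    then show ?thesis by (simp add: comp_def)
  qed
  show "(\<lambda>p. R (fst p) (snd p)) \<in> borel_measurable cube_pair_measure"
  "(\<lambda>p. R (fst p) (fst p)) \<in> borel_measurable cube_pair_measure"
  "(\<lambda>p. R (snd p) (snd p)) \<in> borel_measurable cube_pair_measure"
    by (intro measurable_on_cube_measure_pair * continuous_intros; auto)+
qed

lemma second_moment_kernel_measurable [measurable]:
  "second_moment_kernel d q \<epsilon> \<delta> \<in> borel_measurable cube_pair_measure"
  unfolding second_moment_kernel_def diag_density_def case_prod_unfold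
  by (intro borel_measurable_divide borel_measurable_power borel_measurable_times borel_measurable_const
      borel_measurable_add borel_measurable_diff R_measurable borel_measurable_exp[THEN measurable_compose[rotated]]
      borel_measurable_sqrt[THEN measurable_compose[rotated]] borel_measurable_uminus)

end

section \<open>Convergence of the second moments\<close>

lemma measurable_cube_component [measurable]:
  "(\<lambda>p. fst p $ j) \<in> borel_measurable (cube_pair_measure :: ((real ^ 'n) \<times> (real ^ 'n)) measure)"
  "(\<lambda>p. snd p $ j) \<in> borel_measurable (cube_pair_measure :: ((real ^ 'n) \<times> (real ^ 'n)) measure)"
  by (intro measurable_on_cube_measure_pair continuous_intros)+

lemma measurable_cube_component1 [measurable]:
  "(\<lambda>t. t $ j) \<in> borel_measurable (cube_measure :: (real ^ 'n) measure)"
  by (intro measurable_restrict_space1) simp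

lemma nn_integral_cube_measure_prod:
  fixes f :: "'n::finite \<Rightarrow> real \<Rightarrow> ennreal"
  assumes [measurable]: "\<And>j. f j \<in> borel_measurable borel"
  shows "(\<integral>\<^sup>+t. (\<Prod>j\<in>UNIV. f j (t $ j)) \<partial>cube_measure) = (\<Prod>j\<in>UNIV. \<integral>\<^sup>+u. f j u * indicator {0..1} u \<partial>lborel)"
proof -
  have "(\<integral>\<^sup>+t. (\<Prod>j\<in>UNIV. f j (t $ j)) \<partial>cube_measure)
      = (\<integral>\<^sup>+t. (\<Prod>j\<in>UNIV. f j (t $ j)) * indicator unit_cube t \<partial>lborel)"
    by (rule nn_integral_restrict_space) simp
  also have "\<dots> = (\<integral>\<^sup>+t. (\<Prod>j\<in>UNIV. f j (t $ j) * indicator {0..1} (t $ j)) \<partial>lborel)"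
    by (intro nn_integral_cong) (auto simp: prod.distrib indicator_def mem_unit_cube prod_zero_iff)
  also have "\<dots> = (\<Prod>j\<in>UNIV. \<integral>\<^sup>+u. f j u * indicator {0..1} u \<partial>lborel)"
    by (rule nn_integral_lborel_prod_cart) measurable
  finally show ?thesis .
qed

text \<open>The dominating function. The factors with \<open>s\<^sub>j\<close> come from the variance at \<open>s\<close>; the others
  from the conditional variance at \<open>t\<close> given \<open>s\<close>, whose lower bound degenerates both at \<open>t\<^sub>j = s\<^sub>j\<close>
  and at \<open>t\<^sub>j = 0\<close>. Being a product over the coordinates, it can be integrated one variable at a time.\<close>

definition singular_weight :: "real \<Rightarrow> (real ^ 'n) \<times> (real ^ 'n) \<Rightarrow> real" where
  "singular_weight \<theta> = (\<lambda>(s, t). (\<Prod>j\<in>UNIV. \<bar>s $ j\<bar> powr - \<theta>) *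
     (\<Prod>j\<in>UNIV. \<bar>s $ j - t $ j\<bar> powr - \<theta> + \<bar>t $ j\<bar> powr - \<theta>))"

lemma singular_weight_integrable:
  assumes \<theta>: "0 \<le> \<theta>" "\<theta> < 1"
  shows "integrable (cube_pair_measure :: ((real ^ 'n) \<times> (real ^ 'n)) measure) (singular_weight \<theta>)"
proof (rule integrableI_nonneg)
  interpret C: prob_space "cube_measure :: (real ^ 'n) measure"
    by (rule prob_space_cube_measure)
  define \<kappa> where "\<kappa> = (\<integral>\<^sup>+u. ennreal (\<bar>u\<bar> powr - \<theta>) * indicator {-1..1} u \<partial>lborel)"
  have \<kappa>: "\<kappa> < \<infinity>"
    unfolding \<kappa>_def using nn_integral_abs_powr_finite[OF \<theta>] .
  show meas: "singular_weight \<theta> \<in> borel_measurable (cube_pair_measure :: ((real ^ 'n) \<times> (real ^ 'n)) measure)"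
    unfolding singular_weight_def case_prod_unfold by measurable
  show "AE p in (cube_pair_measure :: ((real ^ 'n) \<times> (real ^ 'n)) measure). 0 \<le> singular_weight \<theta> p"
    by (auto simp: singular_weight_def intro!: mult_nonneg_nonneg prod_nonneg)
  \<comment> \<open>Translating the singularity to the origin bounds the integral uniformly in its position \<open>a\<close>.\<close>
  have one: "(\<integral>\<^sup>+u. ennreal (\<bar>a - u\<bar> powr - \<theta> + \<bar>u\<bar> powr - \<theta>) * indicator {0..1} u \<partial>lborel) \<le> \<kappa> + \<kappa>"
    if a: "0 \<le> a" "a \<le> 1" for a
  proof -
    have "(\<integral>\<^sup>+u. ennreal (\<bar>a - u\<bar> powr - \<theta> + \<bar>u\<bar> powr - \<theta>) * indicator {0..1} u \<partial>lborel)
        \<le> (\<integral>\<^sup>+u. ennreal (\<bar>a - u\<bar> powr - \<theta>) * indicator {-1..1} (a - u) + ennreal (\<bar>u\<bar> powr - \<theta>) * indicator {-1..1} u \<partial>lborel)"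
      using a by (intro nn_integral_mono) (auto simp: indicator_def ennreal_plus)
    also have "\<dots> = (\<integral>\<^sup>+u. ennreal (\<bar>a - u\<bar> powr - \<theta>) * indicator {-1..1} (a - u) \<partial>lborel) + \<kappa>"
      unfolding \<kappa>_def by (rule nn_integral_add) auto
    also have "(\<integral>\<^sup>+u. ennreal (\<bar>a - u\<bar> powr - \<theta>) * indicator {-1..1} (a - u) \<partial>lborel) = \<kappa>"
      unfolding \<kappa>_def by (subst (2) nn_integral_real_affine[where c = "-1" and t = a]) auto
    finally show ?thesis .
  qed
  have "(\<integral>\<^sup>+p. ennreal (singular_weight \<theta> p) \<partial>(cube_pair_measure :: ((real ^ 'n) \<times> (real ^ 'n)) measure))
      = (\<integral>\<^sup>+s. (\<integral>\<^sup>+t. ennreal (singular_weight \<theta> (s :: real ^ 'n, t)) \<partial>cube_measure) \<partial>cube_measure)"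
    using C.nn_integral_fst[of "\<lambda>p. ennreal (singular_weight \<theta> p)" cube_measure, symmetric] meas
    by simp
  also have "\<dots> \<le> (\<integral>\<^sup>+s. (\<Prod>j\<in>UNIV. ennreal (\<bar>s $ j\<bar> powr - \<theta>)) * (\<kappa> + \<kappa>) ^ CARD('n) \<partial>(cube_measure :: (real ^ 'n) measure))"
  proof (rule nn_integral_mono)
    fix s :: "real ^ 'n" assume "s \<in> space cube_measure"
    then have s: "0 \<le> s $ j" "s $ j \<le> 1" for j
      by (auto simp: space_cube_measure mem_unit_cube)
    have "(\<integral>\<^sup>+t. ennreal (singular_weight \<theta> (s, t)) \<partial>cube_measure)
        = (\<integral>\<^sup>+t. (\<Prod>j\<in>UNIV. ennreal (\<bar>s $ j\<bar> powr - \<theta>)) *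
             (\<Prod>j\<in>UNIV. ennreal (\<bar>s $ j - t $ j\<bar> powr - \<theta> + \<bar>t $ j\<bar> powr - \<theta>)) \<partial>cube_measure)"
      by (simp add: singular_weight_def ennreal_mult prod_nonneg prod_ennreal del: ennreal_plus)
    also have "\<dots> = (\<Prod>j\<in>UNIV. ennreal (\<bar>s $ j\<bar> powr - \<theta>)) *
        (\<integral>\<^sup>+t. (\<Prod>j\<in>UNIV. ennreal (\<bar>s $ j - t $ j\<bar> powr - \<theta> + \<bar>t $ j\<bar> powr - \<theta>)) \<partial>cube_measure)"
      by (rule nn_integral_cmult) measurable
    also have "(\<integral>\<^sup>+t. (\<Prod>j\<in>UNIV. ennreal (\<bar>s $ j - t $ j\<bar> powr - \<theta> + \<bar>t $ j\<bar> powr - \<theta>)) \<partial>cube_measure)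
        = (\<Prod>j\<in>UNIV. \<integral>\<^sup>+u. ennreal (\<bar>s $ j - u\<bar> powr - \<theta> + \<bar>u\<bar> powr - \<theta>) * indicator {0..1} u \<partial>lborel)"
      by (rule nn_integral_cube_measure_prod[of "\<lambda>j u. ennreal (\<bar>s $ j - u\<bar> powr - \<theta> + \<bar>u\<bar> powr - \<theta>)"]) measurable
    also have "\<dots> \<le> (\<Prod>j\<in>(UNIV :: 'n set). \<kappa> + \<kappa>)"
      by (intro prod_mono_ennreal one s)
    finally show "(\<integral>\<^sup>+t. ennreal (singular_weight \<theta> (s, t)) \<partial>cube_measure)
        \<le> (\<Prod>j\<in>UNIV. ennreal (\<bar>s $ j\<bar> powr - \<theta>)) * (\<kappa> + \<kappa>) ^ CARD('n)"
      by (simp add: mult_left_mono)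
  qed
  also have "\<dots> = (\<integral>\<^sup>+s. (\<Prod>j\<in>UNIV. ennreal (\<bar>s $ j\<bar> powr - \<theta>)) \<partial>(cube_measure :: (real ^ 'n) measure)) * (\<kappa> + \<kappa>) ^ CARD('n)"
    by (rule nn_integral_multc) measurable
  also have "(\<integral>\<^sup>+s. (\<Prod>j\<in>UNIV. ennreal (\<bar>s $ j\<bar> powr - \<theta>)) \<partial>(cube_measure :: (real ^ 'n) measure))
      = (\<Prod>j\<in>(UNIV :: 'n set). \<integral>\<^sup>+u. ennreal (\<bar>u\<bar> powr - \<theta>) * indicator {0..1} u \<partial>lborel)"
    by (rule nn_integral_cube_measure_prod[of "\<lambda>j u. ennreal (\<bar>u\<bar> powr - \<theta>)"]) measurable
  also have "\<dots> * (\<kappa> + \<kappa>) ^ CARD('n) \<le> (\<Prod>j\<in>(UNIV :: 'n set). \<kappa>) * (\<kappa> + \<kappa>) ^ CARD('n)"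
    unfolding \<kappa>_def by (intro mult_right_mono prod_mono_ennreal nn_integral_mono) (auto simp: indicator_def)
  also have "\<dots> < \<infinity>"
    using \<kappa> by (simp add: ennreal_mult_less_top power_less_top_ennreal)
  finally show "(\<integral>\<^sup>+p. ennreal (singular_weight \<theta> p) \<partial>(cube_pair_measure :: ((real ^ 'n) \<times> (real ^ 'n)) measure)) < \<infinity>" .
qed

lemma AE_lborel_component_neq: "AE t in lborel. (t :: real ^ 'n) $ j \<noteq> c"
  using AE_lborel_inner_neq[of "axis j 1 :: real ^ 'n" c] by (simp add: inner_axis axis_in_Basis_iff)

text \<open>Since \<open>0 powr - \<theta> = 0\<close>, the dominating function says nothing on the hyperplanes where the
  kernel is singular; these have to be discarded as null sets.\<close>

lemma AE_cube_generic:
  "AE p in (cube_pair_measure :: ((real ^ 'n) \<times> (real ^ 'n)) measure).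
     \<forall>j. fst p $ j \<noteq> 0 \<and> snd p $ j \<noteq> 0 \<and> fst p $ j \<noteq> snd p $ j"
proof -
  interpret C: prob_space "cube_measure :: (real ^ 'n) measure"
    by (rule prob_space_cube_measure)
  interpret P: pair_sigma_finite "cube_measure :: (real ^ 'n) measure" "cube_measure :: (real ^ 'n) measure" ..
  have neq: "AE t in (cube_measure :: (real ^ 'n) measure). \<forall>j. t $ j \<noteq> c j" for c
  proof -
    have "AE t in lborel. \<forall>j. (t :: real ^ 'n) $ j \<noteq> c j"
      unfolding AE_all_countable using AE_lborel_component_neq by blast
    then show ?thesis
      by (subst AE_restrict_space_iff) (simp, erule eventually_mono, simp)
  qed
  show ?thesis
  proof (rule P.AE_pair_measure)
    show "{p \<in> space cube_pair_measure. \<forall>j. fst p $ j \<noteq> 0 \<and> snd p $ j \<noteq> 0 \<and> fst p $ j \<noteq> snd p $ j}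
       \<in> sets (cube_pair_measure :: ((real ^ 'n) \<times> (real ^ 'n)) measure)"
      by measurable
    show "AE s in (cube_measure :: (real ^ 'n) measure). AE t in cube_measure.
        \<forall>j. fst (s, t) $ j \<noteq> 0 \<and> snd (s, t) $ j \<noteq> 0 \<and> fst (s, t) $ j \<noteq> snd (s, t) $ j"
      using neq[of "\<lambda>_. 0"]
    proof eventually_elim
      case (elim s)
      from neq[of "\<lambda>_. 0"] neq[of "\<lambda>j. s $ j"] show ?case
        by eventually_elim (metis elim fst_conv snd_conv)
    qed
  qed
qed

lemma inverse_sqrt_power:
  assumes "V > 0" shows "1 / sqrt V ^ d = V powr (- real d / 2)"
proof -
  have "sqrt V ^ d = sqrt V powr real d"
    using assms by (simp add: powr_realpow)
  also have "\<dots> = V powr (real d / 2)"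
    unfolding powr_half_sqrt[OF less_imp_le[OF assms], symmetric] by (simp only: powr_powr) simp
  finally have "sqrt V ^ d = V powr (real d / 2)" .
  then show ?thesis
    using powr_minus_divide[of V "real d / 2"] by simp
qed

lemma min_powr:
  fixes a b h :: real
  assumes "a \<ge> 0" "b \<ge> 0" "h \<ge> 0"
  shows "min (a powr h) (b powr h) = min a b powr h"
  using assms powr_mono2[of h a b] powr_mono2[of h b a] by (auto simp: min_def)

context anisotropic_covariance
begin

text \<open>The witness \<open>m\<close> is the product of the lower bounds for the variance at \<open>s\<close> and for the
  conditional variance at \<open>t\<close> given \<open>s\<close>.\<close>

lemma dominating_bound:
  fixes d :: nat
  assumes st: "s \<in> unit_cube" "t \<in> unit_cube"
    and gen: "\<And>j. s $ j \<noteq> 0" "\<And>j. t $ j \<noteq> 0" "\<And>j. s $ j \<noteq> t $ j"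
    and \<theta>: "\<theta> * (\<Sum>j\<in>UNIV. 1 / H $ j) = real d"
  shows "\<exists>m>0. m \<le> R_det s t \<and> 1 / (2 * pi * sqrt m) ^ d \<le> (1 / (2 * pi * c2)) ^ d * singular_weight \<theta> (s, t)"
proof (intro exI conjI)
  define V1 where "V1 = (\<Sum>j\<in>UNIV. \<bar>s $ j\<bar> powr (2 * H $ j))"
  define V2 where "V2 = (\<Sum>j\<in>UNIV. (min \<bar>s $ j - t $ j\<bar> \<bar>t $ j\<bar>) powr (2 * H $ j))"
  have H0: "0 \<le> 2 * H $ j" for j
    using H_pos[of j] by simp
  have V2_eq: "V2 = (\<Sum>j\<in>UNIV. min (\<bar>s $ j - t $ j\<bar> powr (2 * H $ j)) (\<bar>t $ j\<bar> powr (2 * H $ j)))"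
    unfolding V2_def using H0 by (intro sum.cong refl min_powr[symmetric]) auto
  have V1: "V1 > 0"
    unfolding V1_def using gen by (intro sum_pos) auto
  have V2: "V2 > 0"
    unfolding V2_def using gen by (intro sum_pos) (auto simp: min_def)
  show "0 < c2\<^sup>2 * V1 * V2"
    using V1 V2 c2_pos by simp
  have "c2\<^sup>2 * V1 * V2 = c2 * (c2 * V1) * V2"
    by (simp add: power2_eq_square)
  also have "\<dots> \<le> c2 * R s s * V2"
    using R_diag_lower[OF st(1)] c2_pos V2 unfolding V1_def[symmetric]
    by (intro mult_right_mono mult_left_mono) auto
  also have "\<dots> \<le> R_det s t"
    using R_det_lower[OF st] unfolding V2_eq .
  finally show "c2\<^sup>2 * V1 * V2 \<le> R_det s t" .
  have "1 / (2 * pi * sqrt (c2\<^sup>2 * V1 * V2)) ^ d = (1 / (2 * pi * c2)) ^ d * ((1 / sqrt V1 ^ d) * (1 / sqrt V2 ^ d))"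
    using c2_pos by (simp add: real_sqrt_mult power_mult_distrib power_divide field_simps)
  also have "\<dots> = (1 / (2 * pi * c2)) ^ d * (V1 powr (- real d / 2) * V2 powr (- real d / 2))"
    using V1 V2 by (simp only: inverse_sqrt_power)
  also have "\<dots> \<le> (1 / (2 * pi * c2)) ^ d * singular_weight \<theta> (s, t)"
    unfolding singular_weight_def case_prod_conv
  proof (intro mult_left_mono mult_mono)
    show "V1 powr (- real d / 2) \<le> (\<Prod>j\<in>UNIV. \<bar>s $ j\<bar> powr - \<theta>)"
      unfolding V1_def using gen H_pos \<theta> by (intro sum_powr_le_prod_powr) auto
    have "V2 powr (- real d / 2) \<le> (\<Prod>j\<in>UNIV. (min \<bar>s $ j - t $ j\<bar> \<bar>t $ j\<bar>) powr - \<theta>)"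
      unfolding V2_def using gen H_pos \<theta> by (intro sum_powr_le_prod_powr) auto
    also have "\<dots> \<le> (\<Prod>j\<in>UNIV. \<bar>s $ j - t $ j\<bar> powr - \<theta> + \<bar>t $ j\<bar> powr - \<theta>)"
      by (intro prod_mono) (auto simp: min_def)
    finally show "V2 powr (- real d / 2) \<le> (\<Prod>j\<in>UNIV. \<bar>s $ j - t $ j\<bar> powr - \<theta> + \<bar>t $ j\<bar> powr - \<theta>)" .
  qed (use c2_pos in \<open>auto intro!: prod_nonneg\<close>)
  finally show "1 / (2 * pi * sqrt (c2\<^sup>2 * V1 * V2)) ^ d \<le> (1 / (2 * pi * c2)) ^ d * singular_weight \<theta> (s, t)" .
qed

text \<open>Regularisation increases the determinant, so one integrable function dominates all the kernels. Off
  a null set the unregularised determinant is positive and the kernels converge pointwise.\<close>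

lemma second_moment_kernel_integral_tendsto:
  fixes d :: nat and \<epsilon> \<delta> :: "nat \<Rightarrow> real"
  assumes dim: "real d < (\<Sum>j\<in>UNIV. 1 / H $ j)" and q: "0 \<le> q"
    and \<epsilon>: "\<And>n. 0 < \<epsilon> n" "\<epsilon> \<longlonglongrightarrow> 0" and \<delta>: "\<And>n. 0 < \<delta> n" "\<delta> \<longlonglongrightarrow> 0"
  shows "(\<lambda>n. \<integral>p. second_moment_kernel d q (\<epsilon> n) (\<delta> n) p \<partial>cube_pair_measure)
    \<longlonglongrightarrow> (\<integral>p. second_moment_kernel d q 0 0 p \<partial>cube_pair_measure)"
proof -
  define \<theta> where "\<theta> = real d / (\<Sum>j\<in>UNIV. 1 / H $ j)"
  have Q: "(\<Sum>j\<in>UNIV. 1 / H $ j) > 0"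
    using H_pos by (intro sum_pos) auto
  then have \<theta>: "0 \<le> \<theta>" "\<theta> < 1" "\<theta> * (\<Sum>j\<in>UNIV. 1 / H $ j) = real d"
    using dim by (auto simp: \<theta>_def)
  have mem: "fst p \<in> unit_cube" "snd p \<in> unit_cube" if "p \<in> space cube_pair_measure" for p :: "(real ^ 'n) \<times> (real ^ 'n)"
    using that by (auto simp: space_pair_measure space_cube_measure)
  show ?thesis
  proof (rule integral_dominated_convergence[where w = "\<lambda>p. (1 / (2 * pi * c2)) ^ d * singular_weight \<theta> p"])
    show "integrable cube_pair_measure (\<lambda>p :: (real ^ 'n) \<times> (real ^ 'n). (1 / (2 * pi * c2)) ^ d * singular_weight \<theta> p)"
      by (intro integrable_mult_right singular_weight_integrable \<theta>)
    show "AE p in cube_pair_measure. (\<lambda>n. second_moment_kernel d q (\<epsilon> n) (\<delta> n) p) \<longlonglongrightarrow> second_moment_kernel d q 0 0 p"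
      using AE_cube_generic AE_space
    proof eventually_elim
      case (elim p)
      obtain s t where p: "p = (s, t)" by (cases p)
      obtain m where "m > 0" "m \<le> R_det s t"
        using dominating_bound[of s t \<theta> d] elim mem[of p] \<theta>(3) by (auto simp: p)
      then have "R_det s t > 0" by simp
      then have D: "(R s s + 0) * (R t t + 0) - (R s t)\<^sup>2 \<noteq> 0" "0 < (R s s + 0) * (R t t + 0) - (R s t)\<^sup>2"
        by (simp_all add: R_det_def)
      show ?case
        unfolding p second_moment_kernel_def diag_density_def case_prod_conv
        using D by (intro tendsto_intros \<epsilon> \<delta>) (auto simp: less_imp_neq[symmetric])
    qed
    show "AE p in cube_pair_measure. norm (second_moment_kernel d q (\<epsilon> n) (\<delta> n) p) \<le> (1 / (2 * pi * c2)) ^ d * singular_weight \<theta> p" for n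
      using AE_cube_generic AE_space
    proof eventually_elim
      case (elim p)
      obtain s t where p: "p = (s, t)" by (cases p)
      have st: "s \<in> unit_cube" "t \<in> unit_cube"
        using mem[of p] elim by (auto simp: p)
      have pos: "0 \<le> \<epsilon> n" "0 \<le> \<delta> n"
        using \<epsilon>(1)[of n] \<delta>(1)[of n] by auto
      obtain m where m: "m > 0" "m \<le> R_det s t" 
        "1 / (2 * pi * sqrt m) ^ d \<le> (1 / (2 * pi * c2)) ^ d * singular_weight \<theta> (s, t)"
        using dominating_bound[of s t \<theta> d] elim st \<theta>(3) by (auto simp: p)
      have "m \<le> R_det s t + \<epsilon> n * \<delta> n"
        using m(2) mult_nonneg_nonneg[OF pos] by linarith
      from second_moment_kernel_upper[OF st pos q m(1) this, of d] second_moment_kernel_nonneg[OF st pos, of d q] m(3)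
      show ?case
        unfolding p by simp
    qed
  qed measurable
qed

end

section \<open>Divergence of the second moments\<close>

text \<open>The powers grow at least geometrically with ratio two, so a partial sum is at most twice its
  largest term. This allows a function to be bounded below simultaneously on many nested scales.\<close>

lemma sum_dyadic_le:
  fixes b G :: real
  assumes b: "b \<ge> 2" and G: "G \<ge> 0" and le: "\<And>k. k \<in> {m..<n} \<Longrightarrow> P k \<Longrightarrow> b ^ k \<le> G"
  shows "(\<Sum>k\<in>{m..<n}. b ^ k * of_bool (P k)) \<le> 2 * G"
  using le
proof (induction n)
  case 0
  then show ?case using G by simp
next
  case (Suc n)
  show ?case
  proof (cases "m \<le> n \<and> P n")
    case True
    have geo: "(\<Sum>k<Suc i. b ^ k) \<le> 2 * b ^ i" for i
    proof (induction i)
      case (Suc i)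
      have "2 * b ^ i \<le> b * b ^ i"
        using b by (intro mult_right_mono) auto
      then show ?case using Suc by simp
    qed simp
    have "(\<Sum>k\<in>{m..<Suc n}. b ^ k * of_bool (P k)) \<le> (\<Sum>k\<in>{m..<Suc n}. b ^ k)"
      using b by (intro sum_mono) auto
    also have "\<dots> \<le> (\<Sum>k<Suc n. b ^ k)"
      using b by (intro sum_mono2) auto
    also have "\<dots> \<le> 2 * b ^ n"
      by (rule geo)
    also have "\<dots> \<le> 2 * G"
      using Suc.prems[of n] True by auto
    finally show ?thesis .
  next
    case False
    then have "(\<Sum>k\<in>{m..<Suc n}. b ^ k * of_bool (P k)) = (\<Sum>k\<in>{m..<n}. b ^ k * of_bool (P k))"
      by (auto simp: sum.atLeastLessThan_Suc)
    also have "\<dots> \<le> 2 * G"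
      using Suc.prems by (intro Suc.IH) auto
    finally show ?thesis .
  qed
qed

context anisotropic_covariance
begin

text \<open>Boxes around the diagonal that are adapted to the anisotropic scaling: on the \<open>k\<close>-th one the
  variance of the increment is at most of order \<open>4\<^sup>-\<^sup>k\<close>. Keeping \<open>s\<close> between \<open>1/2\<close> and \<open>3/4\<close> leaves room for
  \<open>t\<close> in the cube and avoids the faces where the variances may vanish.\<close>

definition near_diagonal :: "nat \<Rightarrow> ((real ^ 'n) \<times> (real ^ 'n)) set" where
  "near_diagonal k = {p. \<forall>j. 1/2 \<le> fst p $ j \<and> fst p $ j \<le> 3/4 \<and>
     fst p $ j \<le> snd p $ j \<and> snd p $ j \<le> fst p $ j + (1/2) powr (real k / H $ j)}"

lemma near_diagonal_radius: "k \<ge> 2 \<Longrightarrow> (1/2) powr (real k / H $ j) \<le> 1/4"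
proof -
  assume "k \<ge> 2"
  then have "2 \<le> real k / H $ j"
    using H_pos[of j] H_less[of j] by (simp add: field_simps)
  then have "(1/2) powr (real k / H $ j) \<le> (1/2 :: real) powr 2"
    by (intro powr_mono') auto
  then show ?thesis by (simp add: power2_eq_square)
qed

lemma near_diagonal_subset: "k \<ge> 2 \<Longrightarrow> near_diagonal k \<subseteq> unit_cube \<times> unit_cube"
proof (rule subsetI)
  fix p assume k: "k \<ge> 2" and p: "p \<in> near_diagonal k"
  have "0 \<le> fst p $ j \<and> fst p $ j \<le> 1 \<and> 0 \<le> snd p $ j \<and> snd p $ j \<le> 1" for j
    using p[unfolded near_diagonal_def, simplified, rule_format, of j] near_diagonal_radius[OF k, of j]
    by linarith
  then have "fst p \<in> unit_cube" "snd p \<in> unit_cube"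
    by (auto simp: mem_unit_cube)
  then show "p \<in> unit_cube \<times> unit_cube"
    by (simp add: mem_Times_iff)
qed

lemma near_diagonal_sets:
  assumes "k \<ge> 2" shows "near_diagonal k \<in> sets cube_pair_measure"
proof -
  have "{p \<in> space cube_pair_measure. \<forall>j. 1/2 \<le> fst p $ j \<and> fst p $ j \<le> 3/4 \<and>
     fst p $ j \<le> snd p $ j \<and> snd p $ j \<le> fst p $ j + r j} \<in> sets (cube_pair_measure :: ((real ^ 'n) \<times> (real ^ 'n)) measure)" for r
    by measurable
  from this[of "\<lambda>j. (1/2) powr (real k / H $ j)"]
  have "{p \<in> space cube_pair_measure. p \<in> near_diagonal k} \<in> sets cube_pair_measure"
    unfolding near_diagonal_def mem_Collect_eq .
  also have "{p \<in> space cube_pair_measure. p \<in> near_diagonal k} = near_diagonal k"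
    using near_diagonal_subset[OF assms] unfolding space_pair_measure space_cube_measure by blast
  finally show ?thesis .
qed

lemma measure_near_diagonal:
  assumes k: "k \<ge> 2"
  shows "measure cube_pair_measure (near_diagonal k)
    = (1/4) ^ CARD('n) * (1 / 2 powr (\<Sum>j\<in>UNIV. 1 / H $ j)) ^ k"
proof -
  interpret C: prob_space "cube_measure :: (real ^ 'n) measure"
    by (rule prob_space_cube_measure)
  define r where "r = (\<chi> j. (1/2) powr (real k / H $ j))"
  have r: "0 \<le> r $ j" "r $ j \<le> 1/4" for j
    using near_diagonal_radius[OF k, of j] by (auto simp: r_def)
  let ?B = "cbox (\<chi> j. 1/2) (\<chi> j. 3/4) :: (real ^ 'n) set"
  have slice: "emeasure cube_measure (Pair s -` near_diagonal k) = ennreal (\<Prod>j\<in>UNIV. r $ j) * indicator ?B s" for s :: "real ^ 'n"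
  proof (cases "s \<in> ?B")
    case True
    have eq: "Pair s -` near_diagonal k = cbox s (s + r)"
      using True by (auto simp: near_diagonal_def mem_box_cart r_def)
    have "cbox s (s + r) \<subseteq> unit_cube"
      using near_diagonal_subset[OF k] unfolding eq[symmetric] by auto
    then show ?thesis
      using True r unfolding eq by (subst emeasure_restrict_space) (auto simp: emeasure_lborel_cbox_cart)
  next
    case False
    then have "Pair s -` near_diagonal k = {}"
      by (auto simp: near_diagonal_def mem_box_cart)
    then show ?thesis using False by simp
  qed
  have B: "?B \<subseteq> unit_cube"
  proof (rule subsetI)
    fix x :: "real ^ 'n" assume "x \<in> ?B"
    then have "1/2 \<le> x $ j \<and> x $ j \<le> 3/4" for j
      by (simp add: mem_box_cart)
    then have "0 \<le> x $ j \<and> x $ j \<le> 1" for j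
      using \<open>\<And>j. 1/2 \<le> x $ j \<and> x $ j \<le> 3/4\<close>[of j] by linarith
    then show "x \<in> unit_cube"
      by (simp add: mem_unit_cube)
  qed
  have "emeasure cube_pair_measure (near_diagonal k) = (\<integral>\<^sup>+s. ennreal (\<Prod>j\<in>UNIV. r $ j) * indicator ?B s \<partial>cube_measure)"
    by (subst C.emeasure_pair_measure_alt[OF near_diagonal_sets[OF k]]) (simp only: slice)
  also have "\<dots> = ennreal (\<Prod>j\<in>UNIV. r $ j) * emeasure cube_measure ?B"
    using B by (intro nn_integral_cmult_indicator) (auto simp: sets_restrict_space intro!: image_eqI[of _ _ ?B])
  also have "emeasure cube_measure ?B = ennreal ((1/4) ^ CARD('n))"
    using B by (subst emeasure_restrict_space) (auto simp: emeasure_lborel_cbox_cart)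
  also have "(\<Prod>j\<in>UNIV. r $ j) = (1 / 2 powr (\<Sum>j\<in>UNIV. 1 / H $ j)) ^ k"
  proof -
    have "(\<Prod>j\<in>UNIV. r $ j) = (1/2) powr (\<Sum>j\<in>UNIV. real k / H $ j)"
      by (simp add: r_def powr_sum)
    also have "(\<Sum>j\<in>UNIV. real k / H $ j) = (\<Sum>j\<in>UNIV. 1 / H $ j) * real k"
      by (simp add: sum_distrib_right)
    also have "(1/2) powr ((\<Sum>j\<in>UNIV. 1 / H $ j) * real k) = ((1/2) powr (\<Sum>j\<in>UNIV. 1 / H $ j)) ^ k"
      by (simp add: powr_realpow flip: powr_powr)
    also have "(1/2 :: real) powr (\<Sum>j\<in>UNIV. 1 / H $ j) = 1 / 2 powr (\<Sum>j\<in>UNIV. 1 / H $ j)"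
      by (simp add: powr_divide)
    finally show ?thesis .
  qed
  finally have "emeasure cube_pair_measure (near_diagonal k)
      = ennreal ((1/4) ^ CARD('n) * (1 / 2 powr (\<Sum>j\<in>UNIV. 1 / H $ j)) ^ k)"
    by (simp add: mult.commute flip: ennreal_mult)
  then show ?thesis
    by (simp add: measure_def)
qed

lemma R_diag_bounded: "\<exists>C>0. \<forall>t\<in>unit_cube. R t t \<le> C"
proof -
  have "continuous_on unit_cube ((\<lambda>(s, t). R s t) \<circ> (\<lambda>t. (t, t)))"
    by (intro continuous_on_compose continuous_intros) (auto intro!: continuous_on_subset[OF R_cont])
  then have "continuous_on unit_cube (\<lambda>t. R t t)"
    by (simp add: comp_def)
  then have "compact ((\<lambda>t. R t t) ` unit_cube)"
    by (intro compact_continuous_image) auto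
  then obtain b where "\<forall>x\<in>(\<lambda>t. R t t) ` unit_cube. norm x \<le> b"
    using compact_imp_bounded bounded_iff by metis
  then have "\<forall>t\<in>unit_cube. R t t \<le> max b 1"
    by fastforce
  then show ?thesis
    by (intro exI[of _ "max b 1"]) auto
qed

text \<open>Away from the faces the determinant and the variance of the increment are comparable. Hence the
  exponent in the Gaussian density stays bounded, whatever \<open>x\<close> is, and the prefactor is of order
  at least \<open>(4\<^sup>-\<^sup>k) powr (- d / 2) = 2\<^sup>d\<^sup>k\<close> as soon as the regularisation is not larger than the scale \<open>4\<^sup>-\<^sup>k\<close>.\<close>

lemma second_moment_kernel_lower:
  fixes d :: nat
  assumes q: "0 \<le> q"
  obtains c where "c > 0" "\<And>k \<epsilon> p. k \<ge> 2 \<Longrightarrow> 0 < \<epsilon> \<Longrightarrow> \<epsilon> \<le> (1/4) ^ k \<Longrightarrow> p \<in> near_diagonal k \<Longrightarrow>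
      c * (2 ^ d) ^ k \<le> second_moment_kernel d q \<epsilon> \<epsilon> p"
proof -
  obtain C0 where C0: "C0 > 0" "\<And>t. t \<in> unit_cube \<Longrightarrow> R t t \<le> C0"
    using R_diag_bounded by auto
  \<comment> \<open>\<open>C * 4\<^sup>-\<^sup>k\<close> will bound the regularised determinant, and \<open>K\<close> the ratio of the
    regularised variance of the increment to it.\<close>
  define C where "C = C0 * c1 * real CARD('n) + 2 * C0 + 1"
  define K where "K = 4 * c1 / c2\<^sup>2 + 4 / c2"
  have C: "C > 0"
    using C0 c1_pos by (simp add: C_def add_pos_pos)
  show thesis
  proof (rule that)
    show "0 < exp (- q * K / 2) / (2 * pi * sqrt C) ^ d"
      using C by simp
    fix k and \<epsilon> :: real and p :: "(real ^ 'n) \<times> (real ^ 'n)"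
    assume k: "k \<ge> 2" and \<epsilon>: "0 < \<epsilon>" "\<epsilon> \<le> (1/4) ^ k" and p: "p \<in> near_diagonal k"
    obtain s t where p_eq: "p = (s, t)" by (cases p)
    define \<rho> where "\<rho> = (\<Sum>j\<in>UNIV. \<bar>s $ j - t $ j\<bar> powr (2 * H $ j))"
    have st: "s \<in> unit_cube" "t \<in> unit_cube"
      using near_diagonal_subset[OF k] p by (auto simp: p_eq)
    have coord: "1/2 \<le> s $ j" "1/2 \<le> t $ j" "\<bar>s $ j - t $ j\<bar> \<le> (1/2) powr (real k / H $ j)" for j
      using p[unfolded near_diagonal_def, simplified, rule_format, of j] by (auto simp: p_eq)
    have "\<rho> \<ge> 0"
      unfolding \<rho>_def by (intro sum_nonneg) auto
    have \<rho>: "\<rho> \<le> real CARD('n) * (1/4) ^ k"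
    proof -
      have "\<bar>s $ j - t $ j\<bar> powr (2 * H $ j) \<le> (1/4) ^ k" for j
      proof -
        have "\<bar>s $ j - t $ j\<bar> powr (2 * H $ j) \<le> ((1/2) powr (real k / H $ j)) powr (2 * H $ j)"
          using coord(3)[of j] H_pos[of j] by (intro powr_mono2) auto
        also have "\<dots> = (1/2) powr (real (2 * k))"
          using H_pos[of j] by (simp add: powr_powr mult.commute)
        also have "\<dots> = (1/2) ^ (2 * k)"
          by (rule powr_realpow) simp
        also have "\<dots> = (1/4) ^ k"
          by (simp add: power_mult power2_eq_square)
        finally show ?thesis .
      qed
      then have "\<rho> \<le> (\<Sum>j\<in>(UNIV :: 'n set). (1/4) ^ k)"
        unfolding \<rho>_def by (intro sum_mono)
      then show ?thesis by simp
    qed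
    have diag: "c2 / 4 \<le> R u u" if u: "u \<in> unit_cube" "\<And>j. 1/2 \<le> u $ j" for u
    proof -
      obtain j :: 'n where True by simp
      have "1/4 = (1/2 :: real) powr 2"
        by (simp add: power2_eq_square)
      also have "\<dots> \<le> (1/2) powr (2 * H $ j)"
        using H_less[of j] by (intro powr_mono') auto
      also have "\<dots> \<le> \<bar>u $ j\<bar> powr (2 * H $ j)"
        using u(2)[of j] H_pos[of j] by (intro powr_mono2) auto
      also have "\<dots> \<le> (\<Sum>j\<in>UNIV. \<bar>u $ j\<bar> powr (2 * H $ j))"
        by (rule member_le_sum) auto
      finally have "c2 * (1/4) \<le> c2 * (\<Sum>j\<in>UNIV. \<bar>u $ j\<bar> powr (2 * H $ j))"
        using c2_pos by (intro mult_left_mono) auto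
      then show ?thesis
        using R_diag_lower[OF u(1)] by simp
    qed
    have a: "c2 / 4 \<le> R s s" "c2 / 4 \<le> R t t"
      using diag st coord by auto
    have min_eq: "(\<Sum>j\<in>UNIV. min (\<bar>s $ j - t $ j\<bar> powr (2 * H $ j)) (\<bar>t $ j\<bar> powr (2 * H $ j))) = \<rho>"
      unfolding \<rho>_def
    proof (intro sum.cong refl min_absorb1 powr_mono2)
      fix j
      show "\<bar>s $ j - t $ j\<bar> \<le> \<bar>t $ j\<bar>"
        using coord(1,2)[of j] coord(3)[of j] near_diagonal_radius[OF k, of j] by linarith
      show "0 \<le> 2 * H $ j" using H_pos[of j] by simp
    qed simp
    have det_lower: "(c2\<^sup>2 / 4) * \<rho> \<le> R_det s t"
    proof -
      have "(c2\<^sup>2 / 4) * \<rho> = c2 * (c2 / 4) * \<rho>"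
        by (simp add: power2_eq_square)
      also have "\<dots> \<le> c2 * R s s * \<rho>"
        using a c2_pos \<open>\<rho> \<ge> 0\<close> by (intro mult_right_mono mult_left_mono) auto
      also have "\<dots> \<le> R_det s t"
        using R_det_lower[OF st] unfolding min_eq .
      finally show ?thesis .
    qed
    have incr: "R s s + R t t - 2 * R s t \<le> c1 * \<rho>"
      using R_upper[OF st] unfolding \<rho>_def .
    have det_upper: "R_det s t \<le> C0 * (c1 * \<rho>)"
    proof -
      have "R_det s t \<le> R s s * (R s s + R t t - 2 * R s t)"
        by (rule R_det_upper)
      also have "\<dots> \<le> C0 * (c1 * \<rho>)"
        using incr C0(2)[OF st(1)] C0(1) quad_form_nonneg[OF st, of 1] by (intro mult_mono) auto
      finally show ?thesis .
    qed
    define D where "D = (R s s + \<epsilon>) * (R t t + \<epsilon>) - (R s t)\<^sup>2"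
    have D_eq: "D = R_det s t + \<epsilon> * R t t + \<epsilon> * R s s + \<epsilon> * \<epsilon>"
      unfolding D_def by (rule shifted_det)
    have "D > 0"
      using shifted_det_lower[OF st, of \<epsilon> \<epsilon>] R_det_nonneg[OF st] \<epsilon> mult_pos_pos[of \<epsilon> \<epsilon>] unfolding D_def by linarith
    have D_upper: "D \<le> C * (1/4) ^ k"
    proof -
      have "\<epsilon> \<le> 1"
        using \<epsilon>(2) power_le_one[of "1/4 :: real" k] by simp
      then have "\<epsilon> * \<epsilon> \<le> \<epsilon> * 1"
        using \<epsilon> by (intro mult_left_mono) auto
      moreover have "\<epsilon> * R t t \<le> \<epsilon> * C0" "\<epsilon> * R s s \<le> \<epsilon> * C0"
        using \<epsilon> C0 st by (auto intro!: mult_left_mono)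
      ultimately have "D \<le> C0 * c1 * \<rho> + (2 * C0 + 1) * \<epsilon>"
        using det_upper unfolding D_eq by (simp add: algebra_simps)
      also have "\<dots> \<le> C0 * c1 * (real CARD('n) * (1/4) ^ k) + (2 * C0 + 1) * (1/4) ^ k"
        using \<rho> \<epsilon> C0 c1_pos by (intro add_mono mult_left_mono) auto
      finally show ?thesis
        by (simp add: C_def algebra_simps)
    qed
    have num_upper: "(R s s + \<epsilon>) + (R t t + \<epsilon>) - 2 * R s t \<le> K * D"
    proof -
      have K: "0 \<le> K" using c1_pos c2_pos by (simp add: K_def)
      have "c1 * \<rho> + 2 * \<epsilon> = (4 * c1 / c2\<^sup>2) * ((c2\<^sup>2 / 4) * \<rho>) + (4 / c2) * (\<epsilon> * (c2 / 4) + \<epsilon> * (c2 / 4))"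
        using c2_pos by (simp add: field_simps)
      also have "\<dots> \<le> K * ((c2\<^sup>2 / 4) * \<rho>) + K * (\<epsilon> * (c2 / 4) + \<epsilon> * (c2 / 4))"
        using \<open>\<rho> \<ge> 0\<close> \<epsilon> c1_pos c2_pos unfolding K_def by (intro add_mono mult_right_mono) auto
      also have "\<dots> \<le> K * R_det s t + K * (\<epsilon> * R t t + \<epsilon> * R s s)"
        using K a \<epsilon> det_lower by (intro add_mono mult_left_mono) auto
      also have "\<dots> \<le> K * D"
        unfolding D_eq distrib_left[symmetric] using \<epsilon> by (intro mult_left_mono K) (simp add: algebra_simps)
      finally show ?thesis using incr by simp
    qed
    have "(R s s + \<epsilon> + (R t t + \<epsilon>) - 2 * R s t) / D \<le> K"
      using num_upper \<open>D > 0\<close> by (simp add: field_simps)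
    then have "q * ((R s s + \<epsilon> + (R t t + \<epsilon>) - 2 * R s t) / D) \<le> q * K"
      using q by (intro mult_left_mono)
    then have exp_lower: "exp (- q * K / 2) \<le> exp (- q * (R s s + \<epsilon> + (R t t + \<epsilon>) - 2 * R s t) / (2 * D))"
      by simp
    have "sqrt D \<le> sqrt (C * ((1/2) ^ k)\<^sup>2)"
      using D_upper by (simp add: power2_eq_square flip: power_mult_distrib)
    also have "\<dots> = sqrt C * (1/2) ^ k"
      by (simp add: real_sqrt_mult)
    finally have "(2 * pi * sqrt D) ^ d \<le> (2 * pi * (sqrt C * (1/2) ^ k)) ^ d"
      using \<open>D > 0\<close> by (intro power_mono mult_left_mono) auto
    also have "\<dots> = (2 * pi * sqrt C) ^ d / (2 ^ d) ^ k"
      by (simp add: power_mult_distrib power_divide mult.commute flip: power_mult)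
    finally have pow_upper: "(2 * pi * sqrt D) ^ d \<le> (2 * pi * sqrt C) ^ d / (2 ^ d) ^ k" .
    have "exp (- q * K / 2) / (2 * pi * sqrt C) ^ d * (2 ^ d) ^ k = exp (- q * K / 2) / ((2 * pi * sqrt C) ^ d / (2 ^ d) ^ k)"
      by simp
    also have "\<dots> \<le> exp (- q * (R s s + \<epsilon> + (R t t + \<epsilon>) - 2 * R s t) / (2 * D)) / (2 * pi * sqrt D) ^ d"
      using exp_lower pow_upper \<open>D > 0\<close> by (intro frac_le) auto
    finally show "exp (- q * K / 2) / (2 * pi * sqrt C) ^ d * (2 ^ d) ^ k \<le> second_moment_kernel d q \<epsilon> \<epsilon> p"
      by (simp add: p_eq second_moment_kernel_def diag_density_def D_def)
  qed
qed

lemma second_moment_kernel_integrable: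
  assumes \<epsilon>: "0 < \<epsilon>" "0 < \<delta>" and q: "0 \<le> q"
  shows "integrable cube_pair_measure (second_moment_kernel d q \<epsilon> \<delta>)"
proof -
  interpret C: prob_space "cube_measure :: (real ^ 'n) measure"
    by (rule prob_space_cube_measure)
  interpret P: pair_prob_space "cube_measure :: (real ^ 'n) measure" "cube_measure :: (real ^ 'n) measure" ..
  show ?thesis
  proof (rule P.integrable_const_bound)
    show "AE p in cube_pair_measure. norm (second_moment_kernel d q \<epsilon> \<delta> p) \<le> 1 / (2 * pi * sqrt (\<epsilon> * \<delta>)) ^ d"
    proof (rule AE_I2)
      fix p :: "(real ^ 'n) \<times> (real ^ 'n)" assume "p \<in> space cube_pair_measure"
      then obtain s t where p: "p = (s, t)" and st: "s \<in> unit_cube" "t \<in> unit_cube"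
        by (auto simp: space_pair_measure space_cube_measure)
      have "\<epsilon> * \<delta> \<le> R_det s t + \<epsilon> * \<delta>"
        using R_det_nonneg[OF st] by simp
      from second_moment_kernel_upper[OF st _ _ q _ this, of d] second_moment_kernel_nonneg[OF st, of \<epsilon> \<delta> d q] \<epsilon>
      show "norm (second_moment_kernel d q \<epsilon> \<delta> p) \<le> 1 / (2 * pi * sqrt (\<epsilon> * \<delta>)) ^ d"
        by (simp add: p)
    qed
  qed measurable
qed

text \<open>The box of scale \<open>k\<close> has measure of order \<open>b\<^sup>-\<^sup>k\<close> with \<open>b = 2 powr (\<Sum>1 / H\<^sub>j)\<close>, while the kernel on
  it is of order at least \<open>2\<^sup>d\<^sup>k \<ge> b\<^sup>k\<close>. Every scale therefore contributes a fixed amount, and with the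
  regularisation \<open>4\<^sup>-\<^sup>m\<^sup>-\<^sup>2\<close> there are \<open>m\<close> scales \<open>2, \<dots>, m + 1\<close> at which the lower bound is in force.
  This covers the critical case \<open>b = 2\<^sup>d\<close>, where the divergence is only logarithmic.\<close>

lemma second_moment_kernel_integral_unbounded:
  fixes d :: nat
  assumes dim: "(\<Sum>j\<in>UNIV. 1 / H $ j) \<le> real d" and q: "0 \<le> q"
  obtains c where "c > 0"
    "\<And>m. c * real m \<le> (\<integral>p. second_moment_kernel d q ((1/4) ^ (m + 2)) ((1/4) ^ (m + 2)) p \<partial>cube_pair_measure)"
proof -
  interpret C: prob_space "cube_measure :: (real ^ 'n) measure"
    by (rule prob_space_cube_measure)
  interpret P: pair_prob_space "cube_measure :: (real ^ 'n) measure" "cube_measure :: (real ^ 'n) measure" ..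
  obtain c where c: "c > 0" "\<And>k \<epsilon> p. k \<ge> 2 \<Longrightarrow> 0 < \<epsilon> \<Longrightarrow> \<epsilon> \<le> (1/4) ^ k \<Longrightarrow> p \<in> near_diagonal k \<Longrightarrow>
      c * (2 ^ d) ^ k \<le> second_moment_kernel d q \<epsilon> \<epsilon> p"
    using second_moment_kernel_lower[OF q, of d] by blast
  define b where "b = (2 :: real) powr (\<Sum>j\<in>UNIV. 1 / H $ j)"
  have b: "2 \<le> b"
  proof -
    obtain j :: 'n where True by simp
    have "1 \<le> 1 / H $ j"
      using H_pos[of j] H_less[of j] by simp
    also have "\<dots> \<le> (\<Sum>j\<in>UNIV. 1 / H $ j)"
      using H_pos by (intro member_le_sum) (auto intro: less_imp_le)
    finally have "(2 :: real) powr 1 \<le> b"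
      unfolding b_def by (intro powr_mono) auto
    then show ?thesis by simp
  qed
  have bd: "b \<le> 2 ^ d"
    using powr_mono[OF dim, of 2] by (simp add: b_def powr_realpow)
  show thesis
  proof (rule that)
    show "0 < c / 2 * (1/4) ^ CARD('n)" using c by simp
    fix m :: nat
    define \<epsilon> :: real where "\<epsilon> = (1/4) ^ (m + 2)"
    have "\<epsilon> > 0" by (simp add: \<epsilon>_def)
    define S where "S = {2..<m + 2}"
    have S: "card S = m" "\<And>k. k \<in> S \<Longrightarrow> 2 \<le> k \<and> k \<le> m + 2"
      by (auto simp: S_def)
    let ?f = "\<lambda>p. \<Sum>k\<in>S. (c / 2 * b ^ k) * indicator (near_diagonal k) p"
    have ind: "has_bochner_integral cube_pair_measure (indicator (near_diagonal k)) (measure cube_pair_measure (near_diagonal k))" if "k \<ge> 2" for k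
      using near_diagonal_sets[OF that] by (intro has_bochner_integral_real_indicator) (auto simp: less_top[symmetric] P.emeasure_finite)
    have "c / 2 * (1/4) ^ CARD('n) * real m = (\<Sum>k\<in>S. (c / 2 * b ^ k) * measure cube_pair_measure (near_diagonal k))"
    proof -
      have "(c / 2 * b ^ k) * measure cube_pair_measure (near_diagonal k) = c / 2 * (1/4) ^ CARD('n)" if "k \<in> S" for k
        using b S(2)[OF that] by (simp add: measure_near_diagonal power_divide flip: b_def)
      then have "(\<Sum>k\<in>S. (c / 2 * b ^ k) * measure cube_pair_measure (near_diagonal k)) = (\<Sum>k\<in>S. c / 2 * (1/4) ^ CARD('n))"
        by (intro sum.cong refl)
      then show ?thesis
        using S(1) by (simp only: sum_constant) simp
    qed
    also have "\<dots> = (\<integral>p. ?f p \<partial>cube_pair_measure)"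
      by (intro has_bochner_integral_integral_eq[symmetric] has_bochner_integral_sum has_bochner_integral_mult_right ind)
        (use S(2) in auto)
    also have "\<dots> \<le> (\<integral>p. second_moment_kernel d q \<epsilon> \<epsilon> p \<partial>cube_pair_measure)"
    proof (rule integral_mono)
      show "integrable cube_pair_measure ?f"
        by (intro Bochner_Integration.integrable_sum integrable_mult_right integrable.intros[OF ind]) (use S(2) in auto)
      show "integrable cube_pair_measure (second_moment_kernel d q \<epsilon> \<epsilon>)"
        using \<open>\<epsilon> > 0\<close> q by (intro second_moment_kernel_integrable)
      fix p :: "(real ^ 'n) \<times> (real ^ 'n)" assume "p \<in> space cube_pair_measure"
      then have nn: "0 \<le> second_moment_kernel d q \<epsilon> \<epsilon> p"
        using \<open>\<epsilon> > 0\<close> second_moment_kernel_nonneg[of "fst p" "snd p" \<epsilon> \<epsilon> d q]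
        by (auto simp: space_pair_measure space_cube_measure)
      have "(\<Sum>k\<in>S. b ^ k * of_bool (p \<in> near_diagonal k)) \<le> 2 * (second_moment_kernel d q \<epsilon> \<epsilon> p / c)"
      proof (unfold S_def, rule sum_dyadic_le[OF b])
        fix k assume "k \<in> {2..<m + 2}" and p: "p \<in> near_diagonal k"
        then have k: "k \<ge> 2" "k \<le> m + 2" by auto
        have "c * b ^ k \<le> c * (2 ^ d) ^ k"
          using b bd c(1) by (intro mult_left_mono power_mono) auto
        also have "\<dots> \<le> second_moment_kernel d q \<epsilon> \<epsilon> p"
          using k p \<open>\<epsilon> > 0\<close> power_decreasing[of k "m + 2" "1/4 :: real"]
          by (intro c(2)) (auto simp: \<epsilon>_def)
        finally show "b ^ k \<le> second_moment_kernel d q \<epsilon> \<epsilon> p / c"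
          using c(1) by (simp add: field_simps)
      qed (use nn c(1) in auto)
      then have "c / 2 * (\<Sum>k\<in>S. b ^ k * of_bool (p \<in> near_diagonal k)) \<le> c / 2 * (2 * (second_moment_kernel d q \<epsilon> \<epsilon> p / c))"
        using c(1) by (intro mult_left_mono) auto
      also have "\<dots> = second_moment_kernel d q \<epsilon> \<epsilon> p"
        using c(1) by simp
      finally show "?f p \<le> second_moment_kernel d q \<epsilon> \<epsilon> p"
        by (simp add: sum_distrib_left indicator_def mult.assoc)
    qed
    finally show "c / 2 * (1/4) ^ CARD('n) * real m
      \<le> (\<integral>p. second_moment_kernel d q ((1/4) ^ (m + 2)) ((1/4) ^ (m + 2)) p \<partial>cube_pair_measure)"
      unfolding \<epsilon>_def .
  qed
qed

end

section \<open>Joint measurability and independent coordinates\<close>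

text \<open>Approximating the parameter by lattice points reduces joint measurability to the measurability of
  countably many of the \<open>X t\<close>, and continuity takes care of the limit. Rounding down keeps the lattice
  points inside the cube.\<close>

lemma continuous_field_jointly_measurable:
  fixes X :: "real ^ 'n \<Rightarrow> 'a \<Rightarrow> 'b :: metric_space"
  assumes meas: "\<And>t. t \<in> unit_cube \<Longrightarrow> X t \<in> borel_measurable M"
    and cont: "\<And>\<omega>. \<omega> \<in> space M \<Longrightarrow> continuous_on unit_cube (\<lambda>t. X t \<omega>)"
  shows "(\<lambda>p. X (fst p) (snd p)) \<in> borel_measurable (cube_measure \<Otimes>\<^sub>M M)"
proof (rule borel_measurable_LIMSEQ_metric)
  define grid :: "nat \<Rightarrow> real ^ 'n \<Rightarrow> real ^ 'n" where
    "grid n s = (\<chi> j. of_int \<lfloor>real (Suc n) * s $ j\<rfloor> / real (Suc n))" for n s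
  have grid_bounds: "s $ j - 1 / real (Suc n) \<le> grid n s $ j" "grid n s $ j \<le> s $ j" for n s j
  proof -
    have "real (Suc n) * s $ j - 1 \<le> of_int \<lfloor>real (Suc n) * s $ j\<rfloor>" by linarith
    then have "(real (Suc n) * s $ j - 1) / real (Suc n) \<le> grid n s $ j"
      unfolding grid_def vec_lambda_beta by (intro divide_right_mono) auto
    then show "s $ j - 1 / real (Suc n) \<le> grid n s $ j"
      by (simp add: diff_divide_distrib)
    have "of_int \<lfloor>real (Suc n) * s $ j\<rfloor> \<le> real (Suc n) * s $ j" by linarith
    then have "grid n s $ j \<le> (real (Suc n) * s $ j) / real (Suc n)"
      unfolding grid_def vec_lambda_beta by (intro divide_right_mono) auto
    then show "grid n s $ j \<le> s $ j"
      by simp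
  qed
  have grid_cube: "grid n s \<in> unit_cube" if "s \<in> unit_cube" for n s
  proof -
    have "0 \<le> grid n s $ j \<and> grid n s $ j \<le> 1" for j
    proof
      show "0 \<le> grid n s $ j"
        using that unfolding grid_def mem_unit_cube by simp
      show "grid n s $ j \<le> 1"
        using that grid_bounds(2)[of n s j] unfolding mem_unit_cube by (meson order_trans)
    qed
    then show ?thesis by (simp add: mem_unit_cube)
  qed
  have grid_lim: "(\<lambda>n. grid n s) \<longlonglongrightarrow> s" for s
  proof (rule vec_tendstoI)
    fix j
    have "(\<lambda>n. s $ j - 1 / real (Suc n)) \<longlonglongrightarrow> s $ j - 0"
      using LIMSEQ_inverse_real_of_nat by (intro tendsto_intros) (simp add: inverse_eq_divide)
    then have lim: "(\<lambda>n. s $ j - 1 / real (Suc n)) \<longlonglongrightarrow> s $ j"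
      unfolding diff_0_right .
    show "(\<lambda>n. grid n s $ j) \<longlonglongrightarrow> s $ j"
      by (rule tendsto_sandwich[OF _ _ lim tendsto_const]; rule always_eventually, rule allI, rule grid_bounds)
  qed
  show "(\<lambda>p. X (grid n (fst p)) (snd p)) \<in> borel_measurable (cube_measure \<Otimes>\<^sub>M M)" for n
  proof (rule measurable_compose_countable'[where I = "grid n ` unit_cube" and f = "\<lambda>i p. X i (snd p)" and g = "\<lambda>p. grid n (fst p)"])
    show "(\<lambda>p. X i (snd p)) \<in> borel_measurable (cube_measure \<Otimes>\<^sub>M M)" if "i \<in> grid n ` unit_cube" for i
      using that grid_cube by (intro measurable_compose[OF measurable_snd] meas) auto
    have "grid n ` unit_cube \<subseteq> range (\<lambda>z :: int ^ 'n. \<chi> j. of_int (z $ j) / real (Suc n))"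
    proof
      fix y assume "y \<in> grid n ` unit_cube"
      then obtain s where "y = grid n s" by auto
      then show "y \<in> range (\<lambda>z :: int ^ 'n. \<chi> j. of_int (z $ j) / real (Suc n))"
        by (intro image_eqI[of _ _ "\<chi> j. \<lfloor>real (Suc n) * s $ j\<rfloor>"]) (simp_all add: grid_def)
    qed
    then show count: "countable (grid n ` unit_cube)"
      by (rule countable_subset) auto
    show "(\<lambda>p. grid n (fst p)) \<in> cube_measure \<Otimes>\<^sub>M M \<rightarrow>\<^sub>M count_space (grid n ` unit_cube)"
      unfolding measurable_count_space_eq_countable[OF count]
    proof (intro conjI ballI)
      show "(\<lambda>p. grid n (fst p)) \<in> space (cube_measure \<Otimes>\<^sub>M M) \<rightarrow> grid n ` unit_cube"
        by (auto simp: space_pair_measure space_cube_measure)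
      fix a
      have "(\<lambda>p. grid n (fst p)) -` {a} \<inter> space (cube_measure \<Otimes>\<^sub>M M)
          = {p \<in> space (cube_measure \<Otimes>\<^sub>M M). \<forall>j. of_int \<lfloor>real (Suc n) * fst p $ j\<rfloor> / real (Suc n) = a $ j}"
        by (auto simp: grid_def vec_eq_iff)
      also have "\<dots> \<in> sets (cube_measure \<Otimes>\<^sub>M M)"
      proof -
        have [measurable]: "(\<lambda>p. fst p $ j) \<in> borel_measurable ((cube_measure :: (real ^ 'n) measure) \<Otimes>\<^sub>M M)" for j
          by (rule measurable_compose[OF measurable_fst measurable_cube_component1])
        show ?thesis by measurable
      qed
      finally show "(\<lambda>p. grid n (fst p)) -` {a} \<inter> space (cube_measure \<Otimes>\<^sub>M M) \<in> sets (cube_measure \<Otimes>\<^sub>M M)" .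
    qed
  qed
  show "(\<lambda>n. X (grid n (fst p)) (snd p)) \<longlonglongrightarrow> X (fst p) (snd p)" if "p \<in> space (cube_measure \<Otimes>\<^sub>M M)" for p
  proof -
    have p: "fst p \<in> unit_cube" "snd p \<in> space M"
      using that by (auto simp: space_pair_measure space_cube_measure)
    show ?thesis
      using p grid_cube
      by (intro continuous_on_tendsto_compose[OF cont[OF p(2)] grid_lim]) auto
  qed
qed

text \<open>Boundedness makes both applications of Fubini's theorem legitimate.\<close>

lemma (in prob_space) expectation_prod_integrals:
  fixes f g :: "'s \<Rightarrow> 'a \<Rightarrow> real"
  assumes S: "prob_space S"
    and f[measurable]: "(\<lambda>p. f (fst p) (snd p)) \<in> borel_measurable (S \<Otimes>\<^sub>M M)"
    and g[measurable]: "(\<lambda>p. g (fst p) (snd p)) \<in> borel_measurable (S \<Otimes>\<^sub>M M)"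
    and fK: "\<And>s \<omega>. \<bar>f s \<omega>\<bar> \<le> K" and gK: "\<And>s \<omega>. \<bar>g s \<omega>\<bar> \<le> K'"
  shows "(\<integral>\<omega>. (\<integral>s. f s \<omega> \<partial>S) * (\<integral>s. g s \<omega> \<partial>S) \<partial>M)
       = (\<integral>p. (\<integral>\<omega>. f (fst p) \<omega> * g (snd p) \<omega> \<partial>M) \<partial>(S \<Otimes>\<^sub>M S))"
proof -
  interpret S: prob_space S by fact
  interpret SS: pair_prob_space S S ..
  interpret P: pair_prob_space "S \<Otimes>\<^sub>M S" M ..
  have K: "0 \<le> K" using fK abs_ge_zero order_trans by blast
  have f_s[measurable]: "(\<lambda>s. f s \<omega>) \<in> borel_measurable S" if "\<omega> \<in> space M" for \<omega>
    using measurable_compose[OF measurable_Pair2'[OF that] f] by simp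
  have g_s[measurable]: "(\<lambda>s. g s \<omega>) \<in> borel_measurable S" if "\<omega> \<in> space M" for \<omega>
    using measurable_compose[OF measurable_Pair2'[OF that] g] by simp
  have bound: "\<bar>f s \<omega> * g t \<omega>\<bar> \<le> K * K'" for s t \<omega>
    unfolding abs_mult using fK gK K by (intro mult_mono) auto
  have "(\<integral>s. f s \<omega> \<partial>S) * (\<integral>s. g s \<omega> \<partial>S) = (\<integral>p. f (fst p) \<omega> * g (snd p) \<omega> \<partial>(S \<Otimes>\<^sub>M S))" if \<omega>: "\<omega> \<in> space M" for \<omega>
  proof -
    note [measurable] = f_s[OF \<omega>] g_s[OF \<omega>]
    have "integrable (S \<Otimes>\<^sub>M S) (\<lambda>p. f (fst p) \<omega> * g (snd p) \<omega>)"
      by (rule SS.integrable_const_bound[where B = "K * K'"]) (use bound in auto)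
    from SS.integral_fst'[OF this] show ?thesis
      by simp
  qed
  then have "(\<integral>\<omega>. (\<integral>s. f s \<omega> \<partial>S) * (\<integral>s. g s \<omega> \<partial>S) \<partial>M) = (\<integral>\<omega>. (\<integral>p. f (fst p) \<omega> * g (snd p) \<omega> \<partial>(S \<Otimes>\<^sub>M S)) \<partial>M)"
    by (intro Bochner_Integration.integral_cong refl)
  also have "\<dots> = (\<integral>p. (\<integral>\<omega>. f (fst p) \<omega> * g (snd p) \<omega> \<partial>M) \<partial>(S \<Otimes>\<^sub>M S))"
  proof (rule P.Fubini_integral)
    have [measurable]: "(\<lambda>x. f (fst (fst x)) (snd x)) \<in> borel_measurable ((S \<Otimes>\<^sub>M S) \<Otimes>\<^sub>M M)"
      using measurable_compose[OF _ f, of "\<lambda>x. (fst (fst x), snd x)" "(S \<Otimes>\<^sub>M S) \<Otimes>\<^sub>M M"] by simp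
    have [measurable]: "(\<lambda>x. g (snd (fst x)) (snd x)) \<in> borel_measurable ((S \<Otimes>\<^sub>M S) \<Otimes>\<^sub>M M)"
      using measurable_compose[OF _ g, of "\<lambda>x. (snd (fst x), snd x)" "(S \<Otimes>\<^sub>M S) \<Otimes>\<^sub>M M"] by simp
    show "integrable ((S \<Otimes>\<^sub>M S) \<Otimes>\<^sub>M M) (\<lambda>(p, \<omega>). f (fst p) \<omega> * g (snd p) \<omega>)"
      unfolding case_prod_unfold
      by (rule P.integrable_const_bound[where B = "K * K'"]) (use bound in auto)
  qed
  finally show ?thesis .
qed

lemma independent_copies_expectation_prod:
  fixes X :: "'t \<Rightarrow> 'a \<Rightarrow> real ^ 'd" and X0 :: "'t \<Rightarrow> 'b \<Rightarrow> real"
    and h :: "'d \<Rightarrow> ('t \<Rightarrow> real) \<Rightarrow> real" and K :: real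
  assumes M: "prob_space M" and M0: "prob_space M0"
    and copies: "independent_copies M X M0 X0 T"
    and X0: "\<And>t. t \<in> T \<Longrightarrow> X0 t \<in> borel_measurable M0"
    and h[measurable]: "\<And>i. h i \<in> borel_measurable (Pi\<^sub>M T (\<lambda>_. borel))"
    and K: "\<And>i f. \<bar>h i f\<bar> \<le> K"
  shows "(\<integral>\<omega>. (\<Prod>i\<in>UNIV. h i (\<lambda>t\<in>T. X t \<omega> $ i)) \<partial>M) = (\<Prod>i\<in>UNIV. \<integral>\<omega>. h i (\<lambda>t\<in>T. X0 t \<omega>) \<partial>M0)"
proof -
  interpret M: prob_space M by fact
  interpret M0: prob_space M0 by fact
  have indep: "M.indep_vars (\<lambda>_. Pi\<^sub>M T (\<lambda>_. borel)) (\<lambda>i \<omega>. \<lambda>t\<in>T. X t \<omega> $ i) UNIV"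
    and law: "\<And>i. distr M (Pi\<^sub>M T (\<lambda>_. borel)) (\<lambda>\<omega>. \<lambda>t\<in>T. X t \<omega> $ i) =
          distr M0 (Pi\<^sub>M T (\<lambda>_. borel)) (\<lambda>\<omega>. \<lambda>t\<in>T. X0 t \<omega>)"
    using copies by (auto simp: independent_copies_def)
  have X_meas: "(\<lambda>\<omega>. \<lambda>t\<in>T. X t \<omega> $ i) \<in> M \<rightarrow>\<^sub>M Pi\<^sub>M T (\<lambda>_. borel)" for i
    using indep unfolding M.indep_vars_def by auto
  have X0_meas: "(\<lambda>\<omega>. \<lambda>t\<in>T. X0 t \<omega>) \<in> M0 \<rightarrow>\<^sub>M Pi\<^sub>M T (\<lambda>_. borel)"
    using X0 by (rule measurable_restrict)
  have "(\<integral>\<omega>. (\<Prod>i\<in>UNIV. h i (\<lambda>t\<in>T. X t \<omega> $ i)) \<partial>M) = (\<Prod>i\<in>UNIV. \<integral>\<omega>. h i (\<lambda>t\<in>T. X t \<omega> $ i) \<partial>M)"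
  proof (rule M.indep_vars_lebesgue_integral)
    show "M.indep_vars (\<lambda>_. borel) (\<lambda>i \<omega>. h i (\<lambda>t\<in>T. X t \<omega> $ i)) UNIV"
      using indep h by (rule M.indep_vars_compose2)
    show "integrable M (\<lambda>\<omega>. h i (\<lambda>t\<in>T. X t \<omega> $ i))" for i
      using K measurable_compose[OF X_meas h] by (intro M.integrable_const_bound[where B = K]) auto
  qed simp
  also have "\<dots> = (\<Prod>i\<in>UNIV. \<integral>\<omega>. h i (\<lambda>t\<in>T. X0 t \<omega>) \<partial>M0)"
  proof (intro prod.cong refl)
    show "(\<integral>\<omega>. h i (\<lambda>t\<in>T. X t \<omega> $ i) \<partial>M) = (\<integral>\<omega>. h i (\<lambda>t\<in>T. X0 t \<omega>) \<partial>M0)" for i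
      using integral_distr[OF X_meas h, of i i] integral_distr[OF X0_meas h, of i] by (simp add: law)
  qed
  finally show ?thesis .
qed

lemma heat_kernel_eq_prod:
  fixes y :: "real ^ 'd"
  assumes "\<epsilon> > 0"
  shows "heat_kernel \<epsilon> y = (\<Prod>i\<in>UNIV. normal_density 0 (sqrt \<epsilon>) (y $ i))"
proof -
  have "normal_density 0 (sqrt \<epsilon>) u = (1 / sqrt (2 * pi * \<epsilon>)) * exp (- u\<^sup>2 / (2 * \<epsilon>))" for u
    using assms by (simp add: normal_density_def)
  then have "(\<Prod>i\<in>UNIV. normal_density 0 (sqrt \<epsilon>) (y $ i))
      = (1 / sqrt (2 * pi * \<epsilon>)) ^ CARD('d) * exp (\<Sum>i\<in>UNIV. - (y $ i)\<^sup>2 / (2 * \<epsilon>))"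
    by (simp only: prod.distrib prod_constant exp_sum[OF finite])
  also have "(\<Sum>i\<in>UNIV. - (y $ i)\<^sup>2 / (2 * \<epsilon>)) = - (norm y)\<^sup>2 / (2 * \<epsilon>)"
    by (simp add: norm_vec_def L2_set_def sum_nonneg sum_negf flip: sum_divide_distrib)
  also have "(1 / sqrt (2 * pi * \<epsilon>)) ^ CARD('d) = (2 * pi * \<epsilon>) powr (- real CARD('d) / 2)"
    using assms inverse_sqrt_power[of "2 * pi * \<epsilon>" "CARD('d)"] by (simp add: power_one_over)
  finally show ?thesis
    by (simp add: heat_kernel_def)
qed

lemma heat_kernel_bounds:
  fixes y :: "real ^ 'd"
  assumes "\<epsilon> > 0"
  shows "0 \<le> heat_kernel \<epsilon> y" "heat_kernel \<epsilon> y \<le> (2 * pi * \<epsilon>) powr (- real CARD('d) / 2)"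
  using assms by (auto simp: heat_kernel_def mult_le_cancel_left1)

lemma heat_kernel_measurable [measurable]: "heat_kernel \<epsilon> \<in> borel_measurable borel"
  unfolding heat_kernel_def by measurable

lemma diag_density_prod:
  "(\<Prod>i\<in>(UNIV :: 'd set). exp (- (x $ i)\<^sup>2 * (A + B - 2 * c) / (2 * (A * B - c\<^sup>2))) / (2 * pi * sqrt (A * B - c\<^sup>2)))
    = diag_density CARD('d) ((norm (x :: real ^ 'd))\<^sup>2) A B c"
proof -
  have "(\<Prod>i\<in>(UNIV :: 'd set). exp (- (x $ i)\<^sup>2 * (A + B - 2 * c) / (2 * (A * B - c\<^sup>2))) / (2 * pi * sqrt (A * B - c\<^sup>2)))
     = exp (\<Sum>i\<in>UNIV. - (x $ i)\<^sup>2 * (A + B - 2 * c) / (2 * (A * B - c\<^sup>2))) / (2 * pi * sqrt (A * B - c\<^sup>2)) ^ CARD('d)"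
    by (simp add: prod_dividef exp_sum)
  also have "(\<Sum>i\<in>UNIV. - (x $ i)\<^sup>2 * (A + B - 2 * c) / (2 * (A * B - c\<^sup>2)))
     = - (norm x)\<^sup>2 * (A + B - 2 * c) / (2 * (A * B - c\<^sup>2))"
    by (simp add: norm_vec_def L2_set_def sum_nonneg sum_negf flip: sum_divide_distrib sum_distrib_right)
  finally show ?thesis
    by (simp add: diag_density_def)
qed

section \<open>Moments of the approximate local times\<close>

lemma covariance_anisotropic:
  fixes X0 :: "real ^ 'n \<Rightarrow> 'b \<Rightarrow> real" and H :: "real ^ 'n"
  assumes M0: "prob_space M0" and H: "\<And>j. 0 < H $ j \<and> H $ j < 1"
    and X0: "centered_gaussian_field M0 unit_cube X0"
    and C1: "condition_C1 M0 X0 H" and C2: "condition_C2 M0 X0 H"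
  obtains c1 c2 where "anisotropic_covariance (covariance_fun M0 X0) H c1 c2"
proof -
  interpret M0: prob_space M0 by fact
  have sq: "square_integrable M0 (X0 t)" if "t \<in> unit_cube" for t
  proof (rule M0.gaussian_rv_square_integrable)
    have "gaussian_rv M0 (\<lambda>\<omega>. \<Sum>t\<in>{t}. 1 * X0 t \<omega>)"
      using X0 that unfolding centered_gaussian_field_def gaussian_field_def
      by (elim conjE allE[of _ "{t}"] allE[of _ "\<lambda>_. 1"] impE) simp_all
    then show "gaussian_rv M0 (X0 t)" by simp
  qed
  obtain c1 where c1: "c1 > 0" "\<And>s t. s \<in> unit_cube \<Longrightarrow> t \<in> unit_cube \<Longrightarrow>
     (\<integral>\<omega>. (X0 s \<omega> - X0 t \<omega>)\<^sup>2 \<partial>M0) \<le> c1 * (\<Sum>j\<in>UNIV. \<bar>s $ j - t $ j\<bar> powr (2 * H $ j))"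
    using C1 by (auto simp: condition_C1_def)
  obtain c2 where c2: "c2 > 0" "\<And>s t. s \<in> unit_cube \<Longrightarrow> t \<in> unit_cube \<Longrightarrow>
     AE \<omega> in M0. c2 * (\<Sum>j\<in>UNIV. min (\<bar>s $ j - t $ j\<bar> powr (2 * H $ j)) (\<bar>t $ j\<bar> powr (2 * H $ j)))
       \<le> cond_variance M0 (X0 t) (X0 s) \<omega>"
    using C2 by (auto simp: condition_C2_def)
  have expand: "(\<integral>\<omega>. (X0 t \<omega> - \<beta> * X0 s \<omega>)\<^sup>2 \<partial>M0)
      = covariance_fun M0 X0 t t - 2 * \<beta> * covariance_fun M0 X0 s t + \<beta>\<^sup>2 * covariance_fun M0 X0 s s"
    if s: "s \<in> unit_cube" and t: "t \<in> unit_cube" for s t \<beta>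
  proof -
    have "(\<integral>\<omega>. (X0 t \<omega> - \<beta> * X0 s \<omega>)\<^sup>2 \<partial>M0)
        = (\<integral>\<omega>. X0 t \<omega> * X0 t \<omega> - 2 * \<beta> * (X0 s \<omega> * X0 t \<omega>) + \<beta>\<^sup>2 * (X0 s \<omega> * X0 s \<omega>) \<partial>M0)"
      by (intro Bochner_Integration.integral_cong refl) (simp add: power2_eq_square algebra_simps)
    also have "\<dots> = covariance_fun M0 X0 t t - 2 * \<beta> * covariance_fun M0 X0 s t + \<beta>\<^sup>2 * covariance_fun M0 X0 s s"
      using square_integrable_mult[OF sq[OF t] sq[OF t]] square_integrable_mult[OF sq[OF s] sq[OF t]]
        square_integrable_mult[OF sq[OF s] sq[OF s]]
      by (simp add: covariance_fun_def)
    finally show ?thesis .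
  qed
  have "anisotropic_covariance (covariance_fun M0 X0) H c1 c2"
  proof
    show "0 < H $ j" "H $ j < 1" for j using H by auto
    show "0 < c1" "0 < c2" by fact+
    show "continuous_on (unit_cube \<times> unit_cube) (\<lambda>(s, t). covariance_fun M0 X0 s t)"
      using X0 by (simp add: centered_gaussian_field_def)
  next
    fix s t :: "real ^ 'n" assume st: "s \<in> unit_cube" "t \<in> unit_cube"
    have "(\<integral>\<omega>. (X0 s \<omega> - X0 t \<omega>)\<^sup>2 \<partial>M0) = (\<integral>\<omega>. (X0 t \<omega> - 1 * X0 s \<omega>)\<^sup>2 \<partial>M0)"
      by (simp add: power2_commute)
    then show "covariance_fun M0 X0 s s + covariance_fun M0 X0 t t - 2 * covariance_fun M0 X0 s t
       \<le> c1 * (\<Sum>j\<in>UNIV. \<bar>s $ j - t $ j\<bar> powr (2 * H $ j))"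
      using c1(2)[OF st] unfolding expand[OF st] by simp
    show "c2 * (\<Sum>j\<in>UNIV. min (\<bar>s $ j - t $ j\<bar> powr (2 * H $ j)) (\<bar>t $ j\<bar> powr (2 * H $ j)))
        \<le> covariance_fun M0 X0 t t - 2 * \<beta> * covariance_fun M0 X0 s t + \<beta>\<^sup>2 * covariance_fun M0 X0 s s" for \<beta>
      using M0.cond_variance_lower_bound[OF sq[OF st(2)] sq[OF st(1)] c2(2)[OF st], of \<beta>]
      unfolding expand[OF st] .
  qed
  then show thesis by (rule that)
qed

locale anisotropic_gaussian_copies =
  anisotropic_covariance "covariance_fun M0 X0" H c1 c2 + M: prob_space M + M0: prob_space M0
  for M :: "'a measure" and M0 :: "'b measure" and X0 :: "real ^ 'n \<Rightarrow> 'b \<Rightarrow> real" and H c1 c2 +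
  fixes X :: "real ^ 'n \<Rightarrow> 'a \<Rightarrow> real ^ 'd"
  assumes centered: "centered_gaussian_field M0 unit_cube X0"
    and copies: "independent_copies M X M0 X0 unit_cube"
    and continuous_paths: "\<omega> \<in> space M \<Longrightarrow> continuous_on unit_cube (\<lambda>t. X t \<omega>)"
begin

lemma gaussian_combination:
  assumes s: "s \<in> unit_cube" and t: "t \<in> unit_cube"
  shows "gaussian_rv M0 (\<lambda>\<omega>. u * X0 s \<omega> + v * X0 t \<omega>)"
proof -
  have G: "gaussian_rv M0 (\<lambda>\<omega>. \<Sum>t\<in>F. a t * X0 t \<omega>)" if "finite F" "F \<subseteq> unit_cube" for F a
    using centered that unfolding centered_gaussian_field_def gaussian_field_def by blast
  show ?thesis
  proof (cases "s = t")
    case True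
    then show ?thesis
      using G[of "{t}" "\<lambda>_. u + v"] t by (simp add: distrib_right)
  next
    case False
    then show ?thesis
      using G[of "{s, t}" "\<lambda>r. if r = s then u else v"] s t by simp
  qed
qed

lemma X0_measurable: "t \<in> unit_cube \<Longrightarrow> X0 t \<in> borel_measurable M0"
  using gaussian_combination[of t t 1 0] by (simp add: gaussian_rv_def)

lemma X_measurable:
  assumes "t \<in> unit_cube" shows "X t \<in> borel_measurable M"
proof -
  have "(\<lambda>\<omega>. X t \<omega> $ i) \<in> borel_measurable M" for i
  proof -
    have "(\<lambda>\<omega>. \<lambda>t\<in>unit_cube. X t \<omega> $ i) \<in> M \<rightarrow>\<^sub>M Pi\<^sub>M unit_cube (\<lambda>_. borel)"
      using copies unfolding independent_copies_def M.indep_vars_def by auto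
    from measurable_compose[OF this measurable_component_singleton[OF assms]] assms
    show ?thesis by simp
  qed
  then have "\<forall>b\<in>Basis. (\<lambda>\<omega>. X t \<omega> \<bullet> b) \<in> borel_measurable M"
    by (auto simp: Basis_vec_def inner_axis)
  then show ?thesis
    by (subst borel_measurable_euclidean_space) simp
qed

lemma heat_kernel_X_measurable [measurable]:
  "(\<lambda>p. heat_kernel \<epsilon> (X (fst p) (snd p) - x)) \<in> borel_measurable (cube_measure \<Otimes>\<^sub>M M)"
proof -
  have [measurable]: "(\<lambda>p. X (fst p) (snd p)) \<in> borel_measurable (cube_measure \<Otimes>\<^sub>M M)"
    by (rule continuous_field_jointly_measurable[OF X_measurable continuous_paths])
  show ?thesis by measurable
qed

text \<open>The heat kernel is a product of one-dimensional Gaussian densities, so the independence of the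
  coordinates reduces the expectation to one Gaussian pair per coordinate.\<close>

lemma heat_kernel_cross_moment:
  assumes st: "s \<in> unit_cube" "t \<in> unit_cube" and eps: "\<epsilon> > 0" "\<delta> > 0"
  shows "(\<integral>\<omega>. heat_kernel \<epsilon> (X s \<omega> - x) * heat_kernel \<delta> (X t \<omega> - x) \<partial>M)
       = second_moment_kernel CARD('d) ((norm x)\<^sup>2) \<epsilon> \<delta> (s, t)"
proof -
  define h where "h i f = normal_density 0 (sqrt \<epsilon>) (f s - x $ i) * normal_density 0 (sqrt \<delta>) (f t - x $ i)"
    for i :: 'd and f :: "real ^ 'n \<Rightarrow> real"
  have "(\<integral>\<omega>. heat_kernel \<epsilon> (X s \<omega> - x) * heat_kernel \<delta> (X t \<omega> - x) \<partial>M)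
      = (\<integral>\<omega>. (\<Prod>i\<in>UNIV. h i (\<lambda>t\<in>unit_cube. X t \<omega> $ i)) \<partial>M)"
    using eps st by (simp add: heat_kernel_eq_prod h_def prod.distrib)
  also have "\<dots> = (\<Prod>i\<in>UNIV. \<integral>\<omega>. h i (\<lambda>t\<in>unit_cube. X0 t \<omega>) \<partial>M0)"
  proof (rule independent_copies_expectation_prod[OF M.prob_space_axioms M0.prob_space_axioms copies X0_measurable])
    have [measurable]: "(\<lambda>f. f u) \<in> borel_measurable (Pi\<^sub>M unit_cube (\<lambda>_. borel :: real measure))" if "u \<in> unit_cube" for u :: "real ^ 'n"
      using that by (rule measurable_component_singleton)
    show "h i \<in> borel_measurable (Pi\<^sub>M unit_cube (\<lambda>_. borel))" for i
      using st unfolding h_def by measurable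
    show "\<bar>h i f\<bar> \<le> 1 / sqrt (2 * pi * \<epsilon>) * (1 / sqrt (2 * pi * \<delta>))" for i f
      unfolding h_def abs_mult using eps by (intro mult_mono) (simp_all add: normal_density_le)
  qed
  also have "\<dots> = (\<Prod>i\<in>UNIV. exp (- (x $ i)\<^sup>2 * ((covariance_fun M0 X0 s s + \<epsilon>) + (covariance_fun M0 X0 t t + \<delta>) - 2 * covariance_fun M0 X0 s t)
        / (2 * ((covariance_fun M0 X0 s s + \<epsilon>) * (covariance_fun M0 X0 t t + \<delta>) - (covariance_fun M0 X0 s t)\<^sup>2)))
        / (2 * pi * sqrt ((covariance_fun M0 X0 s s + \<epsilon>) * (covariance_fun M0 X0 t t + \<delta>) - (covariance_fun M0 X0 s t)\<^sup>2)))"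
  proof (rule prod.cong[OF refl])
    fix i :: 'd
    have mean: "(\<integral>\<omega>. X0 u \<omega> \<partial>M0) = 0" if "u \<in> unit_cube" for u
      using centered that by (simp add: centered_gaussian_field_def)
    have "0 < \<epsilon> * \<delta>" using eps by simp
    then have D: "(covariance_fun M0 X0 s s + \<epsilon>) * (covariance_fun M0 X0 t t + \<delta>) - (covariance_fun M0 X0 s t)\<^sup>2 > 0"
      using shifted_det_lower[OF st, of \<epsilon> \<delta>] R_det_nonneg[OF st] eps by linarith
    have "(\<integral>\<omega>. h i (\<lambda>t\<in>unit_cube. X0 t \<omega>) \<partial>M0)
        = (\<integral>\<omega>. normal_density 0 (sqrt \<epsilon>) (X0 s \<omega> - x $ i) * normal_density 0 (sqrt \<delta>) (X0 t \<omega> - x $ i) \<partial>M0)"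
      using st by (simp add: h_def)
    also have "\<dots> = exp (- (x $ i)\<^sup>2 * ((covariance_fun M0 X0 s s + \<epsilon>) + (covariance_fun M0 X0 t t + \<delta>) - 2 * covariance_fun M0 X0 s t)
        / (2 * ((covariance_fun M0 X0 s s + \<epsilon>) * (covariance_fun M0 X0 t t + \<delta>) - (covariance_fun M0 X0 s t)\<^sup>2)))
        / (2 * pi * sqrt ((covariance_fun M0 X0 s s + \<epsilon>) * (covariance_fun M0 X0 t t + \<delta>) - (covariance_fun M0 X0 s t)\<^sup>2))"
      using M0.gaussian_pair_smoothing[OF gaussian_combination[OF st] mean[OF st(1)] mean[OF st(2)] eps, of "x $ i"] D
      by (simp add: covariance_fun_def power2_eq_square)
    finally show "(\<integral>\<omega>. h i (\<lambda>t\<in>unit_cube. X0 t \<omega>) \<partial>M0) = \<dots>" .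
  qed
  also have "\<dots> = second_moment_kernel CARD('d) ((norm x)\<^sup>2) \<epsilon> \<delta> (s, t)"
    unfolding second_moment_kernel_def case_prod_conv by (rule diag_density_prod)
  finally show ?thesis .
qed

abbreviation approx_L where "approx_L \<epsilon> x \<equiv> approx_local_time \<epsilon> x unit_cube X"

lemma approx_local_time_eq: "approx_L \<epsilon> x \<omega> = (\<integral>s. heat_kernel \<epsilon> (X s \<omega> - x) \<partial>cube_measure)"
  unfolding approx_local_time_def set_lebesgue_integral_def
  by (subst integral_restrict_space) simp_all

lemma approx_local_time_square_integrable:
  assumes eps: "\<epsilon> > 0" shows "square_integrable M (approx_L \<epsilon> x)"
proof -
  interpret C: prob_space "cube_measure :: (real ^ 'n) measure"
    by (rule prob_space_cube_measure)
  have swap: "(\<lambda>p. heat_kernel \<epsilon> (X (snd p) (fst p) - x)) \<in> borel_measurable (M \<Otimes>\<^sub>M cube_measure)"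
    using measurable_compose[OF measurable_Pair[OF measurable_snd measurable_fst] heat_kernel_X_measurable] by simp
  then have [measurable]: "approx_L \<epsilon> x \<in> borel_measurable M"
    unfolding approx_local_time_eq[abs_def]
    by (intro C.borel_measurable_lebesgue_integral) (simp add: case_prod_unfold)
  have bound: "\<bar>approx_L \<epsilon> x \<omega>\<bar> \<le> (2 * pi * \<epsilon>) powr (- real CARD('d) / 2)" for \<omega>
  proof -
    have "\<bar>approx_L \<epsilon> x \<omega>\<bar> = approx_L \<epsilon> x \<omega>"
      unfolding approx_local_time_eq by (intro abs_of_nonneg integral_nonneg_AE AE_I2 heat_kernel_bounds(1)[OF eps])
    also have "\<dots> \<le> (\<integral>s. (2 * pi * \<epsilon>) powr (- real CARD('d) / 2) \<partial>(cube_measure :: (real ^ 'n) measure))"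
      unfolding approx_local_time_eq using heat_kernel_bounds[OF eps] by (intro integral_mono_AE') auto
    also have "\<dots> = (2 * pi * \<epsilon>) powr (- real CARD('d) / 2)"
      by (simp only: lebesgue_integral_const C.prob_space scaleR_one)
    finally show ?thesis .
  qed
  have "integrable M (\<lambda>\<omega>. (approx_L \<epsilon> x \<omega>)\<^sup>2)"
  proof (rule M.integrable_const_bound)
    show "AE \<omega> in M. norm ((approx_L \<epsilon> x \<omega>)\<^sup>2) \<le> ((2 * pi * \<epsilon>) powr (- real CARD('d) / 2))\<^sup>2"
    proof (rule AE_I2)
      fix \<omega>
      show "norm ((approx_L \<epsilon> x \<omega>)\<^sup>2) \<le> ((2 * pi * \<epsilon>) powr (- real CARD('d) / 2))\<^sup>2"
        using power_mono[OF bound[of \<omega>] abs_ge_zero, of 2] by simp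
    qed
  qed measurable
  then show ?thesis
    by (simp add: square_integrable_def)
qed

lemma approx_local_time_cross_moment:
  assumes eps: "\<epsilon> > 0" "\<delta> > 0"
  shows "(\<integral>\<omega>. approx_L \<epsilon> x \<omega> * approx_L \<delta> x \<omega> \<partial>M)
       = (\<integral>p. second_moment_kernel CARD('d) ((norm x)\<^sup>2) \<epsilon> \<delta> p \<partial>cube_pair_measure)"
proof -
  define K where "K \<epsilon> = (2 * pi * \<epsilon>) powr (- real CARD('d) / 2)" for \<epsilon>
  have "(\<integral>\<omega>. approx_L \<epsilon> x \<omega> * approx_L \<delta> x \<omega> \<partial>M)
      = (\<integral>p. (\<integral>\<omega>. heat_kernel \<epsilon> (X (fst p) \<omega> - x) * heat_kernel \<delta> (X (snd p) \<omega> - x) \<partial>M) \<partial>cube_pair_measure)"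
    unfolding approx_local_time_eq
  proof (rule M.expectation_prod_integrals[OF prob_space_cube_measure heat_kernel_X_measurable heat_kernel_X_measurable])
    show "\<bar>heat_kernel \<epsilon> (X s \<omega> - x)\<bar> \<le> K \<epsilon>" "\<bar>heat_kernel \<delta> (X s \<omega> - x)\<bar> \<le> K \<delta>" for s \<omega>
      unfolding K_def
      using heat_kernel_bounds[OF eps(1), of "X s \<omega> - x"] heat_kernel_bounds[OF eps(2), of "X s \<omega> - x"]
      by (simp_all only: abs_of_nonneg)
  qed
  also have "\<dots> = (\<integral>p. second_moment_kernel CARD('d) ((norm x)\<^sup>2) \<epsilon> \<delta> p \<partial>cube_pair_measure)"
  proof (rule Bochner_Integration.integral_cong[OF refl])
    fix p :: "(real ^ 'n) \<times> (real ^ 'n)" assume "p \<in> space cube_pair_measure"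
    then have "fst p \<in> unit_cube" "snd p \<in> unit_cube"
      by (auto simp: space_pair_measure space_cube_measure)
    from heat_kernel_cross_moment[OF this eps, of x]
    show "(\<integral>\<omega>. heat_kernel \<epsilon> (X (fst p) \<omega> - x) * heat_kernel \<delta> (X (snd p) \<omega> - x) \<partial>M)
        = second_moment_kernel CARD('d) ((norm x)\<^sup>2) \<epsilon> \<delta> p"
      by simp
  qed
  finally show ?thesis .
qed

end

section \<open>The criterion for existence of local times\<close>

context anisotropic_gaussian_copies
begin

text \<open>The three second moments obtained by expanding the square have the same limit.\<close>

lemma approx_local_time_diff_tendsto:
  assumes dim: "real CARD('d) < (\<Sum>j\<in>UNIV. 1 / H $ j)"
    and \<epsilon>: "\<And>n. 0 < \<epsilon> n" "\<epsilon> \<longlonglongrightarrow> 0" and \<delta>: "\<And>n. 0 < \<delta> n" "\<delta> \<longlonglongrightarrow> 0"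
  shows "(\<lambda>n. \<integral>\<omega>. (approx_L (\<epsilon> n) x \<omega> - approx_L (\<delta> n) x \<omega>)\<^sup>2 \<partial>M) \<longlonglongrightarrow> 0"
proof -
  let ?V = "\<lambda>\<epsilon> \<delta>. \<integral>p. second_moment_kernel CARD('d) ((norm x)\<^sup>2) \<epsilon> \<delta> p \<partial>cube_pair_measure"
  have expand: "(\<integral>\<omega>. (approx_L a x \<omega> - approx_L b x \<omega>)\<^sup>2 \<partial>M) = ?V a a - 2 * ?V a b + ?V b b"
    if "0 < a" "0 < b" for a b
  proof -
    note sq = approx_local_time_square_integrable[of _ x]
    have "(\<integral>\<omega>. (approx_L a x \<omega> - approx_L b x \<omega>)\<^sup>2 \<partial>M)
        = (\<integral>\<omega>. approx_L a x \<omega> * approx_L a x \<omega> - 2 * (approx_L a x \<omega> * approx_L b x \<omega>) + approx_L b x \<omega> * approx_L b x \<omega> \<partial>M)"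
      by (intro Bochner_Integration.integral_cong refl) (simp add: power2_eq_square algebra_simps)
    also have "\<dots> = (\<integral>\<omega>. approx_L a x \<omega> * approx_L a x \<omega> \<partial>M) - 2 * (\<integral>\<omega>. approx_L a x \<omega> * approx_L b x \<omega> \<partial>M)
        + (\<integral>\<omega>. approx_L b x \<omega> * approx_L b x \<omega> \<partial>M)"
      using square_integrable_mult[OF sq sq] that by simp
    finally show ?thesis
      using that by (simp add: approx_local_time_cross_moment)
  qed
  have lim: "(\<lambda>n. ?V (a n) (b n)) \<longlonglongrightarrow> ?V 0 0"
    if "\<And>n. 0 < a n" "a \<longlonglongrightarrow> 0" "\<And>n. 0 < b n" "b \<longlonglongrightarrow> 0" for a b
    using dim that by (intro second_moment_kernel_integral_tendsto) auto
  have "(\<lambda>n. ?V (\<epsilon> n) (\<epsilon> n) - 2 * ?V (\<epsilon> n) (\<delta> n) + ?V (\<delta> n) (\<delta> n)) \<longlonglongrightarrow> ?V 0 0 - 2 * ?V 0 0 + ?V 0 0"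
    by (intro tendsto_add tendsto_diff tendsto_mult tendsto_const lim \<epsilon> \<delta>)
  then show ?thesis
    using \<epsilon>(1) \<delta>(1) by (simp add: expand)
qed

text \<open>Dominated convergence works along sequences; a failure of the uniform statement would supply a
  pair of sequences that contradicts it.\<close>

lemma approx_local_time_cauchy:
  assumes dim: "real CARD('d) < (\<Sum>j\<in>UNIV. 1 / H $ j)" and e: "e > 0"
  shows "\<exists>\<eta>>0. \<forall>\<epsilon> \<delta>. 0 < \<epsilon> \<longrightarrow> \<epsilon> < \<eta> \<longrightarrow> 0 < \<delta> \<longrightarrow> \<delta> < \<eta> \<longrightarrow>
    (\<integral>\<omega>. (approx_L \<epsilon> x \<omega> - approx_L \<delta> x \<omega>)\<^sup>2 \<partial>M) < e"
proof (rule ccontr)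
  define D where "D \<epsilon> \<delta> = (\<integral>\<omega>. (approx_L \<epsilon> x \<omega> - approx_L \<delta> x \<omega>)\<^sup>2 \<partial>M)" for \<epsilon> \<delta>
  assume "\<not> ?thesis"
  then have neg: "\<exists>\<epsilon> \<delta>. 0 < \<epsilon> \<and> \<epsilon> < \<eta> \<and> 0 < \<delta> \<and> \<delta> < \<eta> \<and> e \<le> D \<epsilon> \<delta>" if "\<eta> > 0" for \<eta>
    using that unfolding D_def[symmetric] not_less[symmetric] by blast
  have "\<forall>n. \<exists>p. 0 < fst p \<and> fst p < 1 / real (Suc n) \<and> 0 < snd p \<and> snd p < 1 / real (Suc n) \<and> e \<le> D (fst p) (snd p)"
    using neg by (auto simp del: of_nat_Suc)
  then obtain p where p: "\<And>n. 0 < fst (p n) \<and> fst (p n) < 1 / real (Suc n) \<and> 0 < snd (p n) \<and> snd (p n) < 1 / real (Suc n)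
      \<and> e \<le> D (fst (p n)) (snd (p n))"
    unfolding choice_iff by blast
  define \<epsilon> \<delta> where "\<epsilon> n = fst (p n)" and "\<delta> n = snd (p n)" for n
  have \<epsilon>: "\<And>n. 0 < \<epsilon> n" "\<And>n. \<epsilon> n < 1 / real (Suc n)" and \<delta>: "\<And>n. 0 < \<delta> n" "\<And>n. \<delta> n < 1 / real (Suc n)"
    and ge: "\<And>n. e \<le> D (\<epsilon> n) (\<delta> n)"
    using p unfolding \<epsilon>_def \<delta>_def by blast+
  have null: "(\<lambda>n. 1 / real (Suc n)) \<longlonglongrightarrow> 0"
    using LIMSEQ_inverse_real_of_nat unfolding inverse_eq_divide .
  have "\<epsilon> \<longlonglongrightarrow> 0"
    by (rule tendsto_sandwich[OF _ _ tendsto_const null]; rule always_eventually, rule allI, rule less_imp_le, rule \<epsilon>)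
  moreover have "\<delta> \<longlonglongrightarrow> 0"
    by (rule tendsto_sandwich[OF _ _ tendsto_const null]; rule always_eventually, rule allI, rule less_imp_le, rule \<delta>)
  ultimately have "(\<lambda>n. D (\<epsilon> n) (\<delta> n)) \<longlonglongrightarrow> 0"
    unfolding D_def by (intro approx_local_time_diff_tendsto dim \<epsilon>(1) \<delta>(1))
  then have "e \<le> 0"
    by (rule LIMSEQ_le_const) (use ge in auto)
  then show False using e by simp
qed

lemma local_time_exists:
  assumes dim: "real CARD('d) < (\<Sum>j\<in>UNIV. 1 / H $ j)"
  shows "\<exists>L. tendsto_L2 M (\<lambda>\<epsilon>. approx_L \<epsilon> x) L (at_right 0)"
proof -
  define a where "a n = 1 / real (Suc n)" for n
  have a: "0 < a n" for n by (simp add: a_def)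
  have null: "a \<longlonglongrightarrow> 0"
    using LIMSEQ_inverse_real_of_nat unfolding a_def inverse_eq_divide .
  have cauchy: "\<exists>N. \<forall>m\<ge>N. \<forall>n\<ge>N. (\<integral>\<omega>. (approx_L (a m) x \<omega> - approx_L (a n) x \<omega>)\<^sup>2 \<partial>M) < e" if "e > 0" for e
  proof -
    obtain \<eta> where \<eta>: "\<eta> > 0" "\<And>\<epsilon> \<delta>. 0 < \<epsilon> \<Longrightarrow> \<epsilon> < \<eta> \<Longrightarrow> 0 < \<delta> \<Longrightarrow> \<delta> < \<eta> \<Longrightarrow>
        (\<integral>\<omega>. (approx_L \<epsilon> x \<omega> - approx_L \<delta> x \<omega>)\<^sup>2 \<partial>M) < e"
      using approx_local_time_cauchy[OF dim \<open>e > 0\<close>, of x] by blast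
    obtain N where "\<And>n. n \<ge> N \<Longrightarrow> a n < \<eta>"
      using order_tendstoD(2)[OF null \<eta>(1)] by (auto simp: eventually_sequentially)
    then show ?thesis
      using \<eta>(2) a by (intro exI[of _ N]) auto
  qed
  obtain L where L: "square_integrable M L"
    and conv: "(\<lambda>n. \<integral>\<omega>. (approx_L (a n) x \<omega> - L \<omega>)\<^sup>2 \<partial>M) \<longlonglongrightarrow> 0"
    using M.L2_complete[of "\<lambda>n. approx_L (a n) x", OF approx_local_time_square_integrable[OF a] cauchy] by blast
  have "((\<lambda>\<epsilon>. \<integral>\<omega>. (approx_L \<epsilon> x \<omega> - L \<omega>)\<^sup>2 \<partial>M) \<longlongrightarrow> 0) (at_right 0)"
  proof (rule tendstoI)
    fix e :: real assume "e > 0"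
    then have "e / 4 > 0" by simp
    then obtain \<eta> where \<eta>: "\<eta> > 0" "\<And>\<epsilon> \<delta>. 0 < \<epsilon> \<Longrightarrow> \<epsilon> < \<eta> \<Longrightarrow> 0 < \<delta> \<Longrightarrow> \<delta> < \<eta> \<Longrightarrow>
        (\<integral>\<omega>. (approx_L \<epsilon> x \<omega> - approx_L \<delta> x \<omega>)\<^sup>2 \<partial>M) < e / 4"
      using approx_local_time_cauchy[OF dim, of "e / 4" x] by blast
    have "\<forall>\<^sub>F n in sequentially. a n < \<eta> \<and> (\<integral>\<omega>. (approx_L (a n) x \<omega> - L \<omega>)\<^sup>2 \<partial>M) < e / 4"
      by (intro eventually_conj order_tendstoD(2)[OF null] order_tendstoD(2)[OF conv]) fact+
    then obtain n where n: "a n < \<eta>" "(\<integral>\<omega>. (approx_L (a n) x \<omega> - L \<omega>)\<^sup>2 \<partial>M) < e / 4"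
      by (auto simp: eventually_sequentially)
    have "\<forall>\<^sub>F \<epsilon> in at_right 0. 0 < \<epsilon> \<and> \<epsilon> < \<eta>"
      using \<eta>(1) by (auto simp: eventually_at_right_field)
    then show "\<forall>\<^sub>F \<epsilon> in at_right 0. dist (\<integral>\<omega>. (approx_L \<epsilon> x \<omega> - L \<omega>)\<^sup>2 \<partial>M) 0 < e"
    proof eventually_elim
      case (elim \<epsilon>)
      have "(\<integral>\<omega>. (approx_L \<epsilon> x \<omega> - L \<omega>)\<^sup>2 \<partial>M)
          = (\<integral>\<omega>. ((approx_L \<epsilon> x \<omega> - approx_L (a n) x \<omega>) + (approx_L (a n) x \<omega> - L \<omega>))\<^sup>2 \<partial>M)"
        by simp
      also have "\<dots> \<le> 2 * (\<integral>\<omega>. (approx_L \<epsilon> x \<omega> - approx_L (a n) x \<omega>)\<^sup>2 \<partial>M)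
          + 2 * (\<integral>\<omega>. (approx_L (a n) x \<omega> - L \<omega>)\<^sup>2 \<partial>M)"
        using elim a L by (intro integral_square_triangle square_integrable_diff approx_local_time_square_integrable) auto
      also have "\<dots> < e"
        using \<eta>(2)[of \<epsilon> "a n"] elim a[of n] n by simp
      finally show ?case
        by (simp add: dist_real_def integral_nonneg_AE)
    qed
  qed
  moreover have "\<forall>\<^sub>F \<epsilon> in at_right 0. square_integrable M (approx_L \<epsilon> x)"
    using eventually_at_right_less by eventually_elim (rule approx_local_time_square_integrable)
  ultimately show ?thesis
    using L unfolding tendsto_L2_def by blast
qed

text \<open>An \<open>L\<^sup>2\<close> limit keeps the second moments bounded, whereas they grow without bound when
  \<open>\<Sum>1 / H\<^sub>j \<le> d\<close>.\<close>

lemma dimension_bound_of_local_time: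
  assumes L: "tendsto_L2 M (\<lambda>\<epsilon>. approx_L \<epsilon> x) L (at_right 0)"
  shows "real CARD('d) < (\<Sum>j\<in>UNIV. 1 / H $ j)"
proof (rule ccontr)
  assume "\<not> ?thesis"
  then obtain c where c: "c > 0" "\<And>m. c * real m \<le>
      (\<integral>p. second_moment_kernel CARD('d) ((norm x)\<^sup>2) ((1/4) ^ (m + 2)) ((1/4) ^ (m + 2)) p \<partial>cube_pair_measure)"
    using second_moment_kernel_integral_unbounded[of "CARD('d)" "(norm x)\<^sup>2"] by (auto simp: not_less)
  have sqL: "square_integrable M L"
    and conv: "((\<lambda>\<epsilon>. \<integral>\<omega>. (approx_L \<epsilon> x \<omega> - L \<omega>)\<^sup>2 \<partial>M) \<longlongrightarrow> 0) (at_right 0)"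
    using L by (auto simp: tendsto_L2_def)
  define \<epsilon> :: "nat \<Rightarrow> real" where "\<epsilon> m = (1/4) ^ (m + 2)" for m
  have \<epsilon>: "0 < \<epsilon> m" for m by (simp add: \<epsilon>_def)
  have "(\<lambda>m. (1/4 :: real) ^ m) \<longlonglongrightarrow> 0"
    by (rule LIMSEQ_power_zero) simp
  then have "\<epsilon> \<longlonglongrightarrow> 0"
    unfolding \<epsilon>_def by (rule LIMSEQ_ignore_initial_segment)
  then have "filterlim \<epsilon> (at_right 0) sequentially"
    using \<epsilon> by (intro tendsto_imp_filterlim_at_right always_eventually) auto
  from filterlim_compose[OF conv this]
  have "\<forall>\<^sub>F m in sequentially. (\<integral>\<omega>. (approx_L (\<epsilon> m) x \<omega> - L \<omega>)\<^sup>2 \<partial>M) < 1"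
    by (rule order_tendstoD) simp
  moreover have "\<forall>\<^sub>F m in sequentially. c * real m > 2 + 2 * (\<integral>\<omega>. (L \<omega>)\<^sup>2 \<partial>M)"
    using c(1) by (intro filterlim_at_top_dense[THEN iffD1, rule_format]
      filterlim_tendsto_pos_mult_at_top[OF tendsto_const _ filterlim_real_sequentially])
  ultimately have "\<forall>\<^sub>F m in sequentially. False"
  proof eventually_elim
    case (elim m)
    have "c * real m \<le> (\<integral>\<omega>. approx_L (\<epsilon> m) x \<omega> * approx_L (\<epsilon> m) x \<omega> \<partial>M)"
      using c(2)[of m] unfolding approx_local_time_cross_moment[OF \<epsilon> \<epsilon>] by (simp only: \<epsilon>_def)
    also have "\<dots> = (\<integral>\<omega>. ((approx_L (\<epsilon> m) x \<omega> - L \<omega>) + L \<omega>)\<^sup>2 \<partial>M)"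
      by (simp add: power2_eq_square)
    also have "\<dots> \<le> 2 * (\<integral>\<omega>. (approx_L (\<epsilon> m) x \<omega> - L \<omega>)\<^sup>2 \<partial>M) + 2 * (\<integral>\<omega>. (L \<omega>)\<^sup>2 \<partial>M)"
      by (intro integral_square_triangle square_integrable_diff approx_local_time_square_integrable \<epsilon> sqL)
    finally show ?case
      using elim by simp
  qed
  then show False by simp
qed

end

theorem theorem2p6:
  fixes M :: "'a measure" and M0 :: "'b measure"
    and X :: "real ^ 'n \<Rightarrow> 'a \<Rightarrow> real ^ 'd" and X0 :: "real ^ 'n \<Rightarrow> 'b \<Rightarrow> real"
    and H :: "real ^ 'n"
  assumes "prob_space M" and "prob_space M0"
    and "\<And>j. 0 < H $ j \<and> H $ j < 1"
    and "centered_gaussian_field M0 unit_cube X0"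
    and "condition_C1 M0 X0 H" and "condition_C2 M0 X0 H"
    and "independent_copies M X M0 X0 unit_cube"
    and "\<And>\<omega>. \<omega> \<in> space M \<Longrightarrow> continuous_on unit_cube (\<lambda>t. X t \<omega>)"
  shows "\<forall>x :: real ^ 'd.
    (\<exists>L. tendsto_L2 M (\<lambda>\<epsilon>. approx_local_time \<epsilon> x unit_cube X) L (at_right 0)) \<longleftrightarrow>
    (\<Sum>j\<in>UNIV. 1 / H $ j) > real CARD('d)"
proof -
  obtain c1 c2 where "anisotropic_covariance (covariance_fun M0 X0) H c1 c2"
    using covariance_anisotropic[OF assms(2,3,4,5,6)] by blast
  then interpret anisotropic_gaussian_copies M M0 X0 H c1 c2 X
    using assms by (intro anisotropic_gaussian_copies.intro anisotropic_gaussian_copies_axioms.intro)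
  show ?thesis
    using local_time_exists dimension_bound_of_local_time by blast
qed

end
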